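(* Let $k\geq 1$ and let $G=(V,E)$ be a finite $k$-regular graph that admits a Pfaffian labelling, in which for each $v\in V$ the set of half-edges $\{(v,e):e\ni v\}$ is linearly ordered. Then $$\varepsilon\,P(L(G);k)=(k+1)^{-|V|/2}\sum_{y\in\mathbb{Z}_{k+1}^E}\mathrm{sgn}(y)$$ for some $\varepsilon\in\{+1,-1\}$ depending on the linear orders of the half-edges at the vertices.
   Context: $P(L(G);k)$ is the number of proper edge $k$-colourings of $G$. $\mathbb{Z}_{k+1}$ is ordered $0<1<\cdots<k$. For an injection $\beta$ between linearly ordered sets, $\mathrm{sgn}(\beta)=(-1)^{\#\{\ell<m:\beta(\ell)>\beta(m)\}}$, and $\mathrm{sgn}(\beta)=0$ if $\beta$ is not injective. For $y\in\mathbb{Z}_{k+1}^E$, $\mathrm{sgn}(y)=\prod_{v\in V}\mathrm{sgn}\big(H(v)\to\mathbb{Z}_{k+1},\ (v,e)\mapsto y_e\big)$, where $H(v)$ is the linearly ordered set of half-edges at $v$; thus $\mathrm{sgn}(y)=0$ unless $y$ is a proper edge colouring, and otherwise $\mathrm{sgn}(y)=+1$ or $-1$ according as the number of vertices with sign $-1$ is even or odd. Pfaffian labelling (Norine–Thomas): for a multiplicatively written abelian group $\Gamma$ containing an element $-1$ of order $2$, a map $l:E\to\Gamma$ is Pfaffian if, for a fixed enumeration of $V$, $\mathrm{sgn}(M)\prod_{e\in M}l(e)$ is the same for all perfect matchings $M$, where for $M=\{u_1w_1,\ldots,u_mw_m\}$ with $u_j$ preceding $w_j$, $\mathrm{sgn}(M)$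 is the sign of the permutation taking the enumeration to $u_1,w_1,\ldots,u_m,w_m$; $G$ admits a Pfaffian labelling if such $\Gamma$, $l$ and enumeration exist. *)

theory Defs
  imports Complex_Main "HOL-Library.FuncSet" "HOL-Combinatorics.Permutations"
    "HOL-Algebra.Multiplicative_Group"
begin

(* Graphs are undirected and may have parallel edges, which is why an edge is an abstract
   object carrying its set of ends.  There are no loops: each edge has two distinct ends. *)

record ('v, 'e) graph =
  verts :: "'v set"
  edges :: "'e set"
  ends :: "'e \<Rightarrow> 'v set"

definition finite_graph :: "('v, 'e) graph \<Rightarrow> bool" where
  "finite_graph G \<longleftrightarrow> finite (verts G) \<and> finite (edges G) \<and>
     (\<forall>e\<in>edges G. ends G e \<subseteq> verts G \<and> card (ends G e) = 2)"

definition half_edges :: "('v, 'e) graph \<Rightarrow> 'v \<Rightarrow> ('v \<times> 'e) set" where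
  "half_edges G v = {v} \<times> {e \<in> edges G. v \<in> ends G e}"

definition regular :: "nat \<Rightarrow> ('v, 'e) graph \<Rightarrow> bool" where
  "regular k G \<longleftrightarrow> (\<forall>v\<in>verts G. card (half_edges G v) = k)"

definition proper_edge_colourings :: "('v, 'e) graph \<Rightarrow> nat \<Rightarrow> ('e \<Rightarrow> nat) set" where
  "proper_edge_colourings G k =
     {c \<in> edges G \<rightarrow>\<^sub>E {0..<k}.
        \<forall>e\<in>edges G. \<forall>f\<in>edges G. e \<noteq> f \<and> ends G e \<inter> ends G f \<noteq> {} \<longrightarrow> c e \<noteq> c f}"

(* The value P(L(G); k) of the chromatic polynomial of the line graph of G. *)
definition line_graph_chromatic :: "('v, 'e) graph \<Rightarrow> nat \<Rightarrow> nat" where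
  "line_graph_chromatic G k = card (proper_edge_colourings G k)"

(* The domain A is linearly ordered by the reflexive relation r. *)
definition map_sgn :: "'a set \<Rightarrow> ('a \<times> 'a) set \<Rightarrow> ('a \<Rightarrow> 'b :: linorder) \<Rightarrow> int" where
  "map_sgn A r \<beta> =
     (if inj_on \<beta> A
      then (-1) ^ card {(l, m) \<in> A \<times> A. (l, m) \<in> r \<and> l \<noteq> m \<and> \<beta> l > \<beta> m}
      else 0)"

definition colouring_sgn ::
  "('v, 'e) graph \<Rightarrow> ('v \<Rightarrow> (('v \<times> 'e) \<times> ('v \<times> 'e)) set) \<Rightarrow> ('e \<Rightarrow> nat) \<Rightarrow> int" where
  "colouring_sgn G r y = (\<Prod>v\<in>verts G. map_sgn (half_edges G v) (r v) (\<lambda>(v, e). y e))"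

definition perfect_matching :: "('v, 'e) graph \<Rightarrow> 'e set \<Rightarrow> bool" where
  "perfect_matching G M \<longleftrightarrow> M \<subseteq> edges G \<and> (\<forall>v\<in>verts G. \<exists>!e. e \<in> M \<and> v \<in> ends G e)"

(* The list u1, w1, ..., um, wm for a matching whose edges are listed in es; the two ends
   of each edge appear in the order in which they occur in the enumeration vs. *)
definition matching_list :: "('v, 'e) graph \<Rightarrow> 'v list \<Rightarrow> 'e list \<Rightarrow> 'v list" where
  "matching_list G vs es = concat (map (\<lambda>e. filter (\<lambda>v. v \<in> ends G e) vs) es)"

(* The listing of the edges of M is arbitrary: exchanging two edges in it moves two disjoint
   pairs of vertices, which is an even permutation, so the sign does not change. *)
definition matching_sgn :: "('v, 'e) graph \<Rightarrow> 'v list \<Rightarrow> 'e set \<Rightarrow> int" where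
  "matching_sgn G vs M =
     (let es = (SOME es. distinct es \<and> set es = M)
      in sign (permutation_of_list (zip vs (matching_list G vs es))))"

(* z plays the role of the element -1 of \<Gamma>. *)
definition pfaffian_labelling ::
  "('v, 'e) graph \<Rightarrow> ('g, 'm) monoid_scheme \<Rightarrow> 'g \<Rightarrow> 'v list \<Rightarrow> ('e \<Rightarrow> 'g) \<Rightarrow> bool" where
  "pfaffian_labelling G \<Gamma> z vs l \<longleftrightarrow>
     comm_group \<Gamma> \<and> z \<in> carrier \<Gamma> \<and> group.ord \<Gamma> z = 2 \<and>
     distinct vs \<and> set vs = verts G \<and>
     l \<in> edges G \<rightarrow> carrier \<Gamma> \<and>
     (\<forall>M M'. perfect_matching G M \<and> perfect_matching G M' \<longrightarrow>
        (if matching_sgn G vs M = 1 then \<one>\<^bsub>\<Gamma>\<^esub> else z) \<otimes>\<^bsub>\<Gamma>\<^esub> finprod \<Gamma> l M =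
        (if matching_sgn G vs M' = 1 then \<one>\<^bsub>\<Gamma>\<^esub> else z) \<otimes>\<^bsub>\<Gamma>\<^esub> finprod \<Gamma> l M')"

(* The type argument is the type of the elements of \<Gamma>.  A theorem assuming
   admits_pfaffian_labelling TYPE('g) G for a type variable 'g that occurs nowhere else
   covers labellings by abelian groups over every type. *)
definition admits_pfaffian_labelling :: "'g itself \<Rightarrow> ('v, 'e) graph \<Rightarrow> bool" where
  "admits_pfaffian_labelling _ G \<longleftrightarrow>
     (\<exists>(\<Gamma> :: 'g monoid) z vs l. pfaffian_labelling G \<Gamma> z vs l)"

end

(* The sign of a (k+1)-colouring is a contraction of one alternating tensor per vertex along the
   edges, with the standard symmetric form of R^(k+1) at each edge; hence it does not change if the
   same orthogonal matrix is applied to all tensors.  The tensor at a vertex of degree k is, up to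
   sign, the Hodge dual of the vector (+1, -1, +1, ...) of length sqrt(k+1).  Rotating this vector
   onto the last coordinate axis turns the tensor into sqrt(k+1) times the tensor of
   k-colourings, so for every k-regular graph the sum over (k+1)-colourings is, up to sign,
   (k+1)^(|V|/2) times the sum of sgn over k-colourings.

   A proper k-colouring is a partition into perfect matchings.  Comparing several linear orders of
   the half-edges shows that its sign is the product of the signs of these matchings, up to a
   factor that does not depend on the colouring.  A Pfaffian labelling makes this product
   constant, because the product of the labels over all colour classes is the product over E. *)

theory Submission
  imports Defs "Jordan_Normal_Form.Determinant"
begin

section \<open>Relative signs of tournaments\<close>

text \<open>The signs become comparable because each is written as a relative sign of two orders on
  one finite set, the pairs of a vertex and an edge at it. Relative signs multiply along chains of
  orders, so the links that depend on the colouring can be isolated. Going from vertex-major to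
  colour-major order costs a sign that lives on the fixed set of all pairs (vertex, colour), since
  in a proper \<open>k\<close>-colouring every vertex sees every colour once. Reordering the edges
  costs nothing, because each edge moves a block of two incidences.

  The tensors appear only in coordinates: a rotated vertex tensor is a family of \<open>k\<close> by
  \<open>k\<close> minors of an orthogonal matrix. The complementary minor of an entry is, up to the
  cofactor sign, that entry times the determinant. An alternating last column therefore makes all
  minors that avoid it equal to the same number, 1/sqrt(k+1) up to sign. This number enters once per
  vertex, whence the power (k+1)^(-|V|/2). Without proper \<open>k\<close>-colourings both sides of
  the formula vanish.\<close>

definition tournament_on :: "'a set \<Rightarrow> ('a \<Rightarrow> 'a \<Rightarrow> bool) \<Rightarrow> bool" where
  "tournament_on A R \<longleftrightarrow>
     (\<forall>a\<in>A. \<not> R a a) \<and> (\<forall>a\<in>A. \<forall>b\<in>A. a \<noteq> b \<longrightarrow> R a b \<noteq> R b a)"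

(* The sign of the passage from R to S.  Transitivity is never needed, so tournaments replace
   linear orders throughout. *)
definition order_sgn :: "'a set \<Rightarrow> ('a \<Rightarrow> 'a \<Rightarrow> bool) \<Rightarrow> ('a \<Rightarrow> 'a \<Rightarrow> bool) \<Rightarrow> int" where
  "order_sgn A R S = (-1) ^ card {(a, b) \<in> A \<times> A. R a b \<and> S b a}"

lemma tournament_onD:
  assumes "tournament_on A R" "a \<in> A" "b \<in> A"
  shows "R a b \<longleftrightarrow> a \<noteq> b \<and> \<not> R b a"
  using assms unfolding tournament_on_def by metis

lemma tournament_on_subset: "tournament_on A R \<Longrightarrow> B \<subseteq> A \<Longrightarrow> tournament_on B R"
  unfolding tournament_on_def by blast

lemma tournament_on_cong:
  assumes "tournament_on A R" "\<And>a b. a \<in> A \<Longrightarrow> b \<in> A \<Longrightarrow> R a b = S a b"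
  shows "tournament_on A S"
  using assms unfolding tournament_on_def by metis

lemma tournament_on_inj:
  assumes "tournament_on B R" "inj_on f A" "f ` A \<subseteq> B"
  shows "tournament_on A (\<lambda>x y. R (f x) (f y))"
proof -
  have "f x \<in> B" if "x \<in> A" for x using assms(3) that by auto
  moreover have "f x \<noteq> f y" if "x \<in> A" "y \<in> A" "x \<noteq> y" for x y
    using assms(2) that by (auto dest: inj_onD)
  ultimately show ?thesis using assms(1) unfolding tournament_on_def by metis
qed

lemma finite_Collect_pairs: "finite A \<Longrightarrow> finite {(a, b) \<in> A \<times> A. P a b}"
  by (rule finite_subset[of _ "A \<times> A"]) auto

lemma order_sgn_cases: "order_sgn A R S = 1 \<or> order_sgn A R S = -1"
  unfolding order_sgn_def minus_one_power_iff by auto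

lemma order_sgn_sq [simp]: "order_sgn A R S * order_sgn A R S = 1"
  using order_sgn_cases[of A R S] by auto

lemma order_sgn_cong:
  assumes "\<And>a b. a \<in> A \<Longrightarrow> b \<in> A \<Longrightarrow> R a b = R' a b"
    and "\<And>a b. a \<in> A \<Longrightarrow> b \<in> A \<Longrightarrow> S a b = S' a b"
  shows "order_sgn A R S = order_sgn A R' S'"
proof -
  have "{(a, b) \<in> A \<times> A. R a b \<and> S b a} = {(a, b) \<in> A \<times> A. R' a b \<and> S' b a}"
    using assms by auto
  then show ?thesis unfolding order_sgn_def by simp
qed

lemma order_sgn_eq_1_if_agree:
  assumes "\<And>a b. a \<in> A \<Longrightarrow> b \<in> A \<Longrightarrow> R a b \<Longrightarrow> \<not> S b a"
  shows "order_sgn A R S = 1"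
proof -
  have empty: "{(a, b) \<in> A \<times> A. R a b \<and> S b a} = {}" using assms by auto
  show ?thesis unfolding order_sgn_def empty by simp
qed

text \<open>The parity of the inversions is spread over single pairs, so that relative signs can be
  compared factor by factor.\<close>

lemma order_sgn_eq_prod:
  assumes "finite A"
  shows "order_sgn A R S = (\<Prod>(a, b)\<in>{(a, b) \<in> A \<times> A. R a b}. if S b a then -1 else 1)"
proof -
  let ?P = "{(a, b) \<in> A \<times> A. R a b}" and ?D = "{(a, b) \<in> A \<times> A. R a b \<and> S b a}"
  have "(\<Prod>(a, b)\<in>?P. if S b a then -1 else 1) = (\<Prod>(a, b)\<in>?D. if S b a then -1 else (1::int))"
    using assms by (intro prod.mono_neutral_right finite_Collect_pairs) (auto split: if_splits)
  also have "\<dots> = (\<Prod>p\<in>?D. -1)"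
    by (intro prod.cong) auto
  finally show ?thesis unfolding order_sgn_def by simp
qed

text \<open>Each unordered pair contributes its own factor, which records whether its orientation
  changes; a change from \<open>R\<close> to \<open>S\<close> and one from \<open>S\<close> to
  \<open>T\<close> cancel. The products must be brought to the same index set, the pairs oriented by
  \<open>R\<close>.\<close>

lemma order_sgn_trans:
  assumes fin: "finite A" and R: "tournament_on A R" and S: "tournament_on A S"
    and T: "tournament_on A T"
  shows "order_sgn A R S * order_sgn A S T = order_sgn A R T"
proof -
  have flip: "R b a \<longleftrightarrow> \<not> R a b" "S b a \<longleftrightarrow> \<not> S a b" "T b a \<longleftrightarrow> \<not> T a b"
    if "a \<in> A" "b \<in> A" "a \<noteq> b" for a b
    using tournament_onD[OF R that(2,1)] tournament_onD[OF S that(2,1)]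
      tournament_onD[OF T that(2,1)] that(3) by simp_all
  have irrefl: "a \<noteq> b" if "a \<in> A" "b \<in> A" "R a b \<or> S a b" for a b
    using tournament_onD[OF R that(1,2)] tournament_onD[OF S that(1,2)] that(3) by argo
  let ?P = "\<lambda>R. {(a, b) \<in> A \<times> A. R a b}"
  \<comment> \<open>\<open>?orient R\<close> replaces a pair by its orientation under
    \<open>R\<close>; on the pairs of \<open>S\<close> this is undone by
    \<open>?orient S\<close>.\<close>
  let ?orient = "\<lambda>R (a, b). if R a b then (a, b) else (b, a)"
  \<comment> \<open>On a pair oriented by \<open>R\<close> the direction in \<open>S\<close> is
    unknown; \<open>S a b = T b a\<close> says in either case that \<open>S\<close> and
    \<open>T\<close> disagree.\<close>
  have ST: "order_sgn A S T = (\<Prod>(a, b)\<in>?P R. if S a b = T b a then -1 else 1)"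
    unfolding order_sgn_eq_prod[OF fin]
  proof (rule prod.reindex_bij_witness[of _ "?orient S" "?orient R"])
    fix p
    assume "p \<in> ?P S"
    then obtain a b where p: "p = (a, b)" and ab: "a \<in> A" "b \<in> A" "S a b" by blast
    then have "a \<noteq> b" using irrefl by blast
    note flip = flip[OF ab(1,2) this]
    show "?orient S (?orient R p) = p" "?orient R p \<in> ?P R"
      "(case ?orient R p of (a, b) \<Rightarrow> if S a b = T b a then -1 else 1) =
       (case p of (a, b) \<Rightarrow> if T b a then -1 else (1::int))"
      using ab by (simp_all add: p flip)
  next
    fix p
    assume "p \<in> ?P R"
    then obtain a b where p: "p = (a, b)" and ab: "a \<in> A" "b \<in> A" "R a b" by blast
    then have "a \<noteq> b" using irrefl by blast
    note flip = flip[OF ab(1,2) this]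
    show "?orient R (?orient S p) = p" "?orient S p \<in> ?P S"
      using ab by (simp_all add: p flip)
  qed
  show ?thesis
    unfolding order_sgn_eq_prod[OF fin, of R S] order_sgn_eq_prod[OF fin, of R T] ST
      prod.distrib[symmetric]
  proof (rule prod.cong[OF refl], clarify)
    fix a b
    assume "a \<in> A" "b \<in> A" "R a b"
    then have "S b a \<longleftrightarrow> \<not> S a b" using flip(2) irrefl by blast
    then show "(if S b a then - 1 else 1) * (if S a b = T b a then - 1 else 1) =
        (if T b a then - 1 else (1::int))"
      by simp
  qed
qed

lemma order_sgn_commute:
  assumes "finite A" "tournament_on A R" "tournament_on A S"
  shows "order_sgn A R S = order_sgn A S R"
proof -
  have "order_sgn A R S * order_sgn A S R = order_sgn A R R"
    by (rule order_sgn_trans[OF assms(1,2,3,2)])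
  also have "\<dots> = 1"
    by (rule order_sgn_eq_1_if_agree) (use tournament_onD[OF assms(2)] in blast)
  finally show ?thesis using order_sgn_cases[of A R S] by auto
qed

lemma order_sgn_reindex:
  assumes "bij_betw f A B"
  shows "order_sgn A (\<lambda>x y. R (f x) (f y)) (\<lambda>x y. S (f x) (f y)) = order_sgn B R S"
proof -
  have inj: "inj_on f A" and B: "B = f ` A" using assms by (auto simp: bij_betw_def)
  let ?DA = "{(a, b) \<in> A \<times> A. R (f a) (f b) \<and> S (f b) (f a)}"
  have "inj_on (map_prod f f) ?DA"
    by (rule inj_on_subset[OF map_prod_inj_on[OF inj inj]]) auto
  moreover have "{(a, b) \<in> B \<times> B. R a b \<and> S b a} = map_prod f f ` ?DA"
    (is "?DB = _")
  proof (intro equalityI subrelI)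
    fix x y
    assume "(x, y) \<in> ?DB"
    then have "x \<in> f ` A" "y \<in> f ` A" and RS: "R x y" "S y x" unfolding B by simp_all
    then obtain a b where ab: "a \<in> A" "b \<in> A" "x = f a" "y = f b" by (elim imageE)
    then have "(a, b) \<in> ?DA" using RS by simp
    then have "map_prod f f (a, b) \<in> map_prod f f ` ?DA" by (rule imageI)
    then show "(x, y) \<in> map_prod f f ` ?DA" unfolding ab by simp
  next
    fix x y
    assume "(x, y) \<in> map_prod f f ` ?DA"
    then obtain p where "p \<in> ?DA" "(x, y) = map_prod f f p" by (rule imageE)
    then show "(x, y) \<in> ?DB" unfolding B by (cases p) simp
  qed
  ultimately show ?thesis unfolding order_sgn_def by (simp add: card_image)
qed

(* Besides {a, b}, a pair {y, a} changes its orientation if and only if {y, b} does, so the number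
   of inversions is odd. *)
lemma order_sgn_transpose_aux:
  assumes fin: "finite A" and R: "tournament_on A R"
    and ab: "a \<in> A" "b \<in> A" "a \<noteq> b" "R a b"
  shows "order_sgn A R (\<lambda>x y. R (Transposition.transpose a b x) (Transposition.transpose a b y)) = -1"
proof -
  define I where "I = {y \<in> A. R a y \<and> R y b}"
  define J where "J = {y \<in> A. R y a \<and> R b y}"
  let ?t = "Transposition.transpose a b"
  have nab: "\<not> R b a" "\<not> R a a" "\<not> R b b" using tournament_onD[OF R] ab by blast+
  have IJ: "finite I" "finite J" "a \<notin> I" "b \<notin> I" "a \<notin> J" "b \<notin> J"
    unfolding I_def J_def using fin nab by auto
  let ?D = "{(x, y) \<in> A \<times> A. R x y \<and> R (?t y) (?t x)}"
  let ?E = "(Pair a ` I \<union> (\<lambda>y. (y, b)) ` I) \<union> ((\<lambda>y. (y, a)) ` J \<union> Pair b ` J)"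
  have "?D \<subseteq> insert (a, b) ?E"
  proof (rule subrelI)
    fix x y
    assume "(x, y) \<in> ?D"
    then have xy: "x \<in> A" "y \<in> A" "R x y" "R (?t y) (?t x)" by simp_all
    then have nyx: "\<not> R y x" using tournament_onD[OF R xy(1,2)] xy(3) by simp
    have mem: "(x, y) \<in> insert (a, b) ?E \<longleftrightarrow> x = a \<and> y = b \<or> x = a \<and> y \<in> I \<or> y = b \<and> x \<in> I \<or>
        y = a \<and> x \<in> J \<or> x = b \<and> y \<in> J"
      by auto
    consider "x = a" "y = a" | "x = a" "y = b" | "x = a" "y \<noteq> a" "y \<noteq> b"
      | "x = b" "y = a" | "x = b" "y = b" | "x = b" "y \<noteq> a" "y \<noteq> b"
      | "x \<noteq> a" "x \<noteq> b" "y = a" | "x \<noteq> a" "x \<noteq> b" "y = b"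
      | "x \<noteq> a" "x \<noteq> b" "y \<noteq> a" "y \<noteq> b" by metis
    then show "(x, y) \<in> insert (a, b) ?E"
      unfolding mem by cases (use xy nab nyx in \<open>simp_all add: I_def J_def\<close>)
  qed
  moreover have "insert (a, b) ?E \<subseteq> ?D"
    using ab nab IJ by (auto simp: I_def J_def Transposition.transpose_def)
  ultimately have D: "?D = insert (a, b) ?E" by (rule subset_antisym)
  have "card (Pair a ` I \<union> (\<lambda>y. (y, b)) ` I) = card I + card I"
    using IJ by (subst card_Un_disjoint) (auto simp: card_image inj_on_def)
  moreover have "card ((\<lambda>y. (y, a)) ` J \<union> Pair b ` J) = card J + card J"
    using IJ by (subst card_Un_disjoint) (auto simp: card_image inj_on_def)
  moreover have "card ?E = card (Pair a ` I \<union> (\<lambda>y. (y, b)) ` I) + card ((\<lambda>y. (y, a)) ` J \<union> Pair b ` J)"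
    by (rule card_Un_disjoint) (use IJ ab in auto)
  moreover have "card ?D = Suc (card ?E)"
    unfolding D by (rule card_insert_disjoint) (use IJ ab in auto)
  ultimately have "card ?D = Suc (2 * (card I + card J))" by simp
  then show ?thesis unfolding order_sgn_def by (simp only: power_Suc power_mult) simp
qed

lemma order_sgn_transpose:
  assumes "finite A" "tournament_on A R" "a \<in> A" "b \<in> A" "a \<noteq> b"
  shows "order_sgn A R (\<lambda>x y. R (Transposition.transpose a b x) (Transposition.transpose a b y)) = -1"
proof (cases "R a b")
  case True
  then show ?thesis by (rule order_sgn_transpose_aux[OF assms])
next
  case False
  then have "R b a" using tournament_onD[OF assms(2,4,3)] assms(5) by simp
  then show ?thesis
    using order_sgn_transpose_aux[OF assms(1,2,4,3)] assms(5) by (simp add: transpose_commute)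
qed

text \<open>Induction over transpositions: pulling back along \<open>p\<close> turns the comparison
  of \<open>p\<close> with \<open>p\<close> followed by a transposition into that of
  \<open>R\<close> with its transposed copy, which contributes -1. This ties relative signs to
  \<open>sign\<close>, both for matchings and for determinants.\<close>

lemma order_sgn_permutes:
  assumes p: "p permutes A" and fin: "finite A" and R: "tournament_on A R"
  shows "order_sgn A R (\<lambda>x y. R (p x) (p y)) = sign p"
  using p fin
proof (induction rule: permutes_induct)
  case id
  have "order_sgn A R R = 1"
    by (rule order_sgn_eq_1_if_agree) (use tournament_onD[OF R] in blast)
  then show ?case by (simp add: sign_id)
next
  case (swap a b p)
  let ?t = "Transposition.transpose a b"
  note p = \<open>p permutes A\<close> and ab = \<open>a \<in> A\<close> \<open>b \<in> A\<close> \<open>a \<noteq> b\<close>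
  have t: "?t permutes A" using ab by (simp add: permutes_swap_id)
  have tp: "tournament_on A (\<lambda>x y. R (p x) (p y))"
    by (rule tournament_on_inj[OF R])
      (use p in \<open>simp_all add: permutes_inj_on permutes_image\<close>)
  have ttp: "tournament_on A (\<lambda>x y. R ((?t \<circ> p) x) ((?t \<circ> p) y))"
    by (rule tournament_on_inj[OF R])
      (use permutes_compose[OF p t] in \<open>simp_all add: permutes_inj_on permutes_image del: comp_apply\<close>)
  have "order_sgn A (\<lambda>x y. R (p x) (p y)) (\<lambda>x y. R ((?t \<circ> p) x) ((?t \<circ> p) y)) =
        order_sgn A R (\<lambda>x y. R (?t x) (?t y))"
    unfolding comp_def
    by (rule order_sgn_reindex[OF permutes_imp_bij[OF p], where R = R and S = "\<lambda>x y. R (?t x) (?t y)"])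
  also have "\<dots> = -1" by (rule order_sgn_transpose[OF fin R ab])
  finally have "order_sgn A R (\<lambda>x y. R ((?t \<circ> p) x) ((?t \<circ> p) y)) = - sign p"
    using order_sgn_trans[OF fin R tp ttp] swap.IH by simp
  also have "\<dots> = sign (?t \<circ> p)"
    using p ab by (simp add: sign_compose sign_swap_id permutes_imp_permutation[OF fin]
        permutation_swap_id)
  finally show ?case .
qed

text \<open>No inversion joins two different fibres of \<open>f\<close>, so the inversion set is the
  disjoint union of its parts inside the fibres.\<close>

lemma order_sgn_fibres:
  assumes fin: "finite A" and I: "finite I" "f ` A \<subseteq> I"
    and eq: "\<And>a b. a \<in> A \<Longrightarrow> b \<in> A \<Longrightarrow> R a b \<Longrightarrow> S b a \<Longrightarrow> f a = f b"
  shows "order_sgn A R S = (\<Prod>i\<in>I. order_sgn {a \<in> A. f a = i} R S)"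
proof -
  let ?D = "\<lambda>B. {(a, b) \<in> B \<times> B. R a b \<and> S b a}"
  have "?D A = (\<Union>i\<in>I. ?D {a \<in> A. f a = i})"
  proof (intro equalityI subrelI)
    fix a b
    assume "(a, b) \<in> ?D A"
    then have ab: "a \<in> A" "b \<in> A" "R a b" "S b a" by simp_all
    have f: "f b = f a" by (rule eq[OF ab, symmetric])
    have "f a \<in> I" using I(2) ab(1) by blast
    then show "(a, b) \<in> (\<Union>i\<in>I. ?D {a \<in> A. f a = i})"
      by (rule UN_I) (use ab f in simp)
  next
    fix a b
    assume "(a, b) \<in> (\<Union>i\<in>I. ?D {a \<in> A. f a = i})"
    then show "(a, b) \<in> ?D A" by (elim UN_E) simp
  qed
  moreover have "card (\<Union>i\<in>I. ?D {a \<in> A. f a = i}) = (\<Sum>i\<in>I. card (?D {a \<in> A. f a = i}))"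
  proof (rule card_UN_disjoint)
    show "\<forall>i\<in>I. finite (?D {a \<in> A. f a = i})"
      using fin by (intro ballI finite_Collect_pairs) simp
    show "\<forall>i\<in>I. \<forall>j\<in>I. i \<noteq> j \<longrightarrow> ?D {a \<in> A. f a = i} \<inter> ?D {a \<in> A. f a = j} = {}"
      by blast
  qed (rule I)
  ultimately have "card (?D A) = (\<Sum>i\<in>I. card (?D {a \<in> A. f a = i}))" by (simp only:)
  then show ?thesis unfolding order_sgn_def by (simp only: power_sum)
qed

section \<open>The sign of a perfect matching\<close>

definition before :: "'a list \<Rightarrow> 'a \<Rightarrow> 'a \<Rightarrow> bool" where
  "before xs u v \<longleftrightarrow> (\<exists>i j. i < j \<and> j < length xs \<and> xs ! i = u \<and> xs ! j = v)"

text \<open>All orders of incidences below have this shape. The tie-breaker \<open>Q\<close> is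
  consulted only inside a fibre of \<open>f\<close> and has to be a tournament only there.\<close>

definition lex_order :: "('b \<Rightarrow> 'b \<Rightarrow> bool) \<Rightarrow> ('a \<Rightarrow> 'b) \<Rightarrow> ('a \<Rightarrow> 'a \<Rightarrow> bool) \<Rightarrow> 'a \<Rightarrow> 'a \<Rightarrow> bool" where
  "lex_order P f Q a b \<longleftrightarrow> P (f a) (f b) \<or> f a = f b \<and> Q a b"

lemma tournament_on_lex_order:
  assumes P: "tournament_on B P" and f: "f ` A \<subseteq> B"
    and Q: "\<And>b. b \<in> B \<Longrightarrow> tournament_on {a \<in> A. f a = b} Q"
  shows "tournament_on A (lex_order P f Q)"
  unfolding tournament_on_def
proof (intro conjI ballI impI)
  fix a
  assume "a \<in> A"
  then have "f a \<in> B" "a \<in> {x \<in> A. f x = f a}" using f by auto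
  then show "\<not> lex_order P f Q a a"
    using tournament_onD[OF P, of "f a" "f a"] tournament_onD[OF Q, of "f a" a a]
    by (simp add: lex_order_def)
next
  fix a b
  assume ab: "a \<in> A" "b \<in> A" "a \<noteq> b"
  then have B: "f a \<in> B" "f b \<in> B" using f by auto
  show "lex_order P f Q a b \<noteq> lex_order P f Q b a"
  proof (cases "f a = f b")
    case True
    have "Q a b \<longleftrightarrow> \<not> Q b a"
      using tournament_onD[OF Q[OF B(1)], of a b] ab True by simp
    then show ?thesis
      using tournament_onD[OF P B(1) B(1)] True by (simp add: lex_order_def)
  next
    case False
    then show ?thesis
      using tournament_onD[OF P B] by (simp add: lex_order_def)
  qed
qed

lemma before_nth:
  assumes "distinct xs" "i < length xs" "j < length xs"
  shows "before xs (xs ! i) (xs ! j) \<longleftrightarrow> i < j"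
  using assms unfolding before_def by (metis nth_eq_iff_index_eq order_less_trans)

lemma tournament_on_before: 
  assumes "distinct xs"
  shows "tournament_on (set xs) (before xs)"
  unfolding tournament_on_def
proof (intro conjI ballI impI)
  fix a b
  assume "a \<in> set xs" "b \<in> set xs" "a \<noteq> b"
  then obtain i j where "i < length xs" "j < length xs" "a = xs ! i" "b = xs ! j" "i \<noteq> j"
    by (metis in_set_conv_nth)
  then show "before xs a b \<noteq> before xs b a"
    using before_nth[OF assms] by auto
next
  fix a
  assume "a \<in> set xs"
  then obtain i where "i < length xs" "a = xs ! i" by (metis in_set_conv_nth)
  then show "\<not> before xs a a" using before_nth[OF assms, of i i] by simp
qed

lemma sorted_wrt_before: "distinct xs \<Longrightarrow> sorted_wrt (before xs) xs"
  unfolding sorted_wrt_iff_nth_less before_def by blast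

lemma sorted_wrt_concat:
  "sorted_wrt P (concat xss) \<longleftrightarrow> (\<forall>xs\<in>set xss. sorted_wrt P xs) \<and>
     sorted_wrt (\<lambda>xs ys. \<forall>x\<in>set xs. \<forall>y\<in>set ys. P x y) xss"
  by (induction xss) (auto simp: sorted_wrt_append)

lemma distinct_if_sorted_wrt:
  "sorted_wrt P xs \<Longrightarrow> (\<And>x. x \<in> set xs \<Longrightarrow> \<not> P x x) \<Longrightarrow> distinct xs"
  by (induction xs) auto

text \<open>For distinct elements exactly one direction holds on either side, so the implication
  given by sortedness is an equivalence.\<close>

lemma before_iff_if_sorted_wrt:
  assumes P: "tournament_on (set xs) P" and sorted: "sorted_wrt P xs"
    and uv: "u \<in> set xs" "v \<in> set xs"
  shows "before xs u v \<longleftrightarrow> P u v"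
proof
  assume "before xs u v"
  then show "P u v" using sorted unfolding before_def sorted_wrt_iff_nth_less by blast
next
  assume "P u v"
  then have uv': "u \<noteq> v" "\<not> P v u" using tournament_onD[OF P uv] by simp_all
  obtain i j where ij: "i < length xs" "j < length xs" "xs ! i = u" "xs ! j = v"
    using uv by (metis in_set_conv_nth)
  have "i \<noteq> j" using uv' ij by auto
  moreover have "\<not> j < i"
    using sorted uv' ij unfolding sorted_wrt_iff_nth_less by blast
  ultimately have "i < j" by simp
  then show "before xs u v" using ij unfolding before_def by blast
qed

text \<open>The list that defines the matching sign is the vertex set sorted by matching edge, in
  the chosen listing of edges, and then by the enumeration \<open>vs\<close>. The sign of the
  permutation taking \<open>vs\<close> to it is therefore a relative sign of two orders. The listing
  is handed out existentially because it stems from the choice operator in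
  \<open>matching_sgn\<close>; \<open>m\<close> sends a vertex to its matching edge.\<close>

lemma matching_sgn_eq_order_sgn:
  assumes vs: "distinct vs" "set vs = verts G" and M: "perfect_matching G M" "finite M"
    and m: "\<And>v. v \<in> verts G \<Longrightarrow> m v \<in> M \<and> v \<in> ends G (m v)"
  obtains es where "distinct es" "set es = M"
    "matching_sgn G vs M = order_sgn (verts G) (before vs) (lex_order (before es) m (before vs))"
proof -
  define es where "es = (SOME es. distinct es \<and> set es = M)"
  have "\<exists>es. distinct es \<and> set es = M" using finite_distinct_list[OF M(2)] by blast
  then have es: "distinct es" "set es = M" unfolding es_def by (metis (mono_tags, lifting) someI_ex)+
  define L where "L = lex_order (before es) m (before vs)"
  define ws where "ws = matching_list G vs es"
  define p where "p = permutation_of_list (zip vs ws)"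
  have m_eq: "m v = e" if "v \<in> verts G" "e \<in> M" "v \<in> ends G e" for v e
    using M(1) m[OF that(1)] that unfolding perfect_matching_def by blast
  have bV: "tournament_on (verts G) (before vs)" using tournament_on_before[OF vs(1)] vs(2) by simp
  have L: "tournament_on (verts G) L"
    unfolding L_def
    by (rule tournament_on_lex_order[OF tournament_on_before[OF es(1)]])
      (use m es in \<open>auto intro: tournament_on_subset[OF bV]\<close>)
  have set_ws: "set ws = verts G"
    unfolding ws_def matching_list_def using m by (auto simp: es vs)
  have "sorted_wrt L ws"
    unfolding ws_def matching_list_def sorted_wrt_concat sorted_wrt_map
  proof (intro conjI ballI)
    fix xs
    assume "xs \<in> set (map (\<lambda>e. filter (\<lambda>v. v \<in> ends G e) vs) es)"
    then obtain e where e: "e \<in> M" "xs = filter (\<lambda>v. v \<in> ends G e) vs" using es by auto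
    have "sorted_wrt (before vs) xs"
      unfolding e(2) by (rule sorted_wrt_filter) (rule sorted_wrt_before[OF vs(1)])
    then show "sorted_wrt L xs"
    proof (rule sorted_wrt_mono_rel[rotated])
      fix u v
      assume "u \<in> set xs" "v \<in> set xs" "before vs u v"
      moreover from this have "m u = e" "m v = e" using m_eq e vs by auto
      ultimately show "L u v" unfolding L_def lex_order_def by simp
    qed
  next
    show "sorted_wrt (\<lambda>e f. \<forall>u\<in>set (filter (\<lambda>v. v \<in> ends G e) vs).
        \<forall>v\<in>set (filter (\<lambda>v. v \<in> ends G f) vs). L u v) es"
    proof (rule sorted_wrt_mono_rel[OF _ sorted_wrt_before[OF es(1)]], intro ballI)
      fix e f u v
      assume ef: "e \<in> set es" "f \<in> set es" "before es e f"
        and "u \<in> set (filter (\<lambda>v. v \<in> ends G e) vs)" "v \<in> set (filter (\<lambda>v. v \<in> ends G f) vs)"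
      then have "m u = e" "m v = f" using m_eq vs es by auto
      then show "L u v" unfolding L_def lex_order_def using ef by simp
    qed
  qed
  note sorted = this
  have dist_ws: "distinct ws"
    by (rule distinct_if_sorted_wrt[OF sorted]) (use tournament_onD[OF L] set_ws in blast)
  have len: "length ws = length vs"
    using distinct_card[OF dist_ws] distinct_card[OF vs(1)] set_ws vs(2) by simp
  have perm: "list_permutes (zip vs ws) (verts G)"
    by (rule list_permutesI) (use len vs set_ws dist_ws in \<open>simp_all add: map_fst_zip map_snd_zip\<close>)
  then have p: "p permutes verts G" unfolding p_def by simp
  have p_nth: "p (vs ! i) = ws ! i" if "i < length vs" for i
    unfolding p_def
    by (rule permutation_of_list_unique[OF perm]) (use that len in \<open>auto simp: set_zip\<close>)
  have bp: "before ws (p u) (p v) \<longleftrightarrow> before vs u v" if uv: "u \<in> verts G" "v \<in> verts G" for u v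
  proof -
    obtain i j where "i < length vs" "j < length vs" "u = vs ! i" "v = vs ! j"
      using uv vs(2) by (metis in_set_conv_nth)
    then show ?thesis using p_nth before_nth[OF dist_ws] before_nth[OF vs(1)] len by simp
  qed
  have bws: "before ws u v \<longleftrightarrow> L u v" if "u \<in> verts G" "v \<in> verts G" for u v
    using before_iff_if_sorted_wrt[OF _ sorted] L set_ws that by simp
  have bw: "tournament_on (verts G) (before ws)"
    using tournament_on_before[OF dist_ws] set_ws by simp
  have fin: "finite (verts G)" using vs(2) by (metis List.finite_set)
  have "matching_sgn G vs M = sign p"
    unfolding matching_sgn_def p_def ws_def es_def Let_def ..
  \<comment> \<open>\<open>p\<close> carries \<open>before vs\<close> to \<open>before ws\<close>,
    so pulling \<open>before ws\<close> back along \<open>p\<close> gives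
    \<open>before vs\<close>.\<close>
  also have "\<dots> = order_sgn (verts G) (before ws) (\<lambda>u v. before ws (p u) (p v))"
    by (rule order_sgn_permutes[OF p fin bw, symmetric])
  also have "\<dots> = order_sgn (verts G) L (before vs)"
    by (rule order_sgn_cong) (simp_all add: bws bp)
  also have "\<dots> = order_sgn (verts G) (before vs) L"
    by (rule order_sgn_commute[OF fin L bV])
  finally show ?thesis using es that unfolding L_def by blast
qed

lemma matching_sgn_cases: "matching_sgn G vs M = 1 \<or> matching_sgn G vs M = -1"
  unfolding matching_sgn_def Let_def sign_def by simp

section \<open>The sign of a proper colouring\<close>

text \<open>The disjoint union of the sets \<open>half_edges G v\<close>, the common ground set on
  which orders are compared.\<close>

definition incidences :: "('v, 'e) graph \<Rightarrow> ('v \<times> 'e) set" where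
  "incidences G = {(v, e). v \<in> verts G \<and> e \<in> edges G \<and> v \<in> ends G e}"

definition colour_class :: "('v, 'e) graph \<Rightarrow> ('e \<Rightarrow> nat) \<Rightarrow> nat \<Rightarrow> 'e set" where
  "colour_class G x c = {e \<in> edges G. x e = c}"

lemma finite_incidences: "finite_graph G \<Longrightarrow> finite (incidences G)"
  unfolding incidences_def finite_graph_def
  by (rule finite_subset[of _ "verts G \<times> edges G"]) auto

lemma half_edges_eq_fibre: "v \<in> verts G \<Longrightarrow> half_edges G v = {h \<in> incidences G. fst h = v}"
  unfolding incidences_def half_edges_def by auto

lemma finite_half_edges: "finite_graph G \<Longrightarrow> finite (half_edges G v)"
  unfolding half_edges_def finite_graph_def by simp

text \<open>Two distinct edges with a common end are two half-edges at that end, so properness can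
  be tested vertex by vertex, by the same injectivity that makes \<open>map_sgn\<close>
  nonzero.\<close>

lemma proper_edge_colourings_iff:
  assumes "finite_graph G"
  shows "x \<in> proper_edge_colourings G k \<longleftrightarrow>
    x \<in> edges G \<rightarrow>\<^sub>E {0..<k} \<and> (\<forall>v\<in>verts G. inj_on (\<lambda>h. x (snd h)) (half_edges G v))"
proof -
  have "ends G e \<subseteq> verts G" if "e \<in> edges G" for e
    using assms that unfolding finite_graph_def by blast
  then have "(\<forall>v\<in>verts G. inj_on (\<lambda>h. x (snd h)) (half_edges G v)) \<longleftrightarrow>
      (\<forall>e\<in>edges G. \<forall>f\<in>edges G. e \<noteq> f \<and> ends G e \<inter> ends G f \<noteq> {} \<longrightarrow> x e \<noteq> x f)"
    unfolding inj_on_def half_edges_def by fastforce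
  then show ?thesis unfolding proper_edge_colourings_def by blast
qed

text \<open>Regularity enters here: an injection of \<open>k\<close> half-edges into
  \<open>k\<close> colours is onto.\<close>

lemma bij_betw_colours_at_vertex:
  assumes "finite_graph G" "regular k G" "x \<in> proper_edge_colourings G k" "v \<in> verts G"
  shows "bij_betw (\<lambda>h. x (snd h)) (half_edges G v) {0..<k}"
proof -
  have inj: "inj_on (\<lambda>h. x (snd h)) (half_edges G v)" and x: "x \<in> edges G \<rightarrow>\<^sub>E {0..<k}"
    using assms proper_edge_colourings_iff[OF assms(1)] by blast+
  have sub: "(\<lambda>h. x (snd h)) ` half_edges G v \<subseteq> {0..<k}"
    using x unfolding half_edges_def by auto
  have "card ((\<lambda>h. x (snd h)) ` half_edges G v) = card {0..<k}"
    using card_image[OF inj] assms(2,4) unfolding regular_def by simp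
  then have "(\<lambda>h. x (snd h)) ` half_edges G v = {0..<k}"
    by (intro card_subset_eq sub) simp_all
  then show ?thesis using inj unfolding bij_betw_def by blast
qed

lemma ex1_edge_of_colour:
  assumes "finite_graph G" "regular k G" "x \<in> proper_edge_colourings G k" "v \<in> verts G" "c < k"
  shows "\<exists>!e. e \<in> colour_class G x c \<and> v \<in> ends G e"
proof -
  have bij: "bij_betw (\<lambda>h. x (snd h)) (half_edges G v) {0..<k}"
    by (rule bij_betw_colours_at_vertex[OF assms(1-4)])
  then have "c \<in> (\<lambda>h. x (snd h)) ` half_edges G v"
    using assms(5) by (simp add: bij_betw_def)
  then obtain e where e: "(v, e) \<in> half_edges G v" "x e = c" unfolding half_edges_def by auto
  show ?thesis
  proof (rule ex1I[of _ e])
    show "e \<in> colour_class G x c \<and> v \<in> ends G e"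
      using e by (simp add: colour_class_def half_edges_def)
  next
    fix f
    assume "f \<in> colour_class G x c \<and> v \<in> ends G f"
    then have "(v, f) \<in> half_edges G v" "x f = c" by (simp_all add: colour_class_def half_edges_def)
    then have "(v, f) = (v, e)"
      using e bij_betw_imp_inj_on[OF bij] by (intro inj_onD[of "\<lambda>h. x (snd h)"]) simp_all
    then show "f = e" by simp
  qed
qed

lemma perfect_matching_colour_class:
  assumes "finite_graph G" "regular k G" "x \<in> proper_edge_colourings G k" "c < k"
  shows "perfect_matching G (colour_class G x c)"
  using ex1_edge_of_colour[OF assms(1-3) _ assms(4)] unfolding perfect_matching_def
  by (auto simp: colour_class_def)

text \<open>At a single vertex \<open>fst\<close> is constant and \<open>P\<close> is irreflexive,
  so both lexicographic orders reduce to their tie-breakers. The outer key is added so that the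
  signs at the vertices become restrictions of two orders of all incidences.\<close>

lemma map_sgn_eq_order_sgn:
  fixes x :: "'e \<Rightarrow> nat"
  assumes "inj_on (\<lambda>h. x (snd h)) (half_edges G v)" "\<not> P v v"
  shows "map_sgn (half_edges G v) r (\<lambda>(v, e). x e) =
     order_sgn (half_edges G v) (lex_order P fst (\<lambda>a b. (a, b) \<in> r \<and> a \<noteq> b))
       (lex_order P fst (\<lambda>a b. x (snd a) < x (snd b)))"
proof -
  have eq1: "(\<lambda>(v, e). x e) = (\<lambda>h. x (snd h))" by auto
  have eq2: "{(a, b) \<in> half_edges G v \<times> half_edges G v. (a, b) \<in> r \<and> a \<noteq> b \<and> x (snd b) < x (snd a)} =
    {(a, b) \<in> half_edges G v \<times> half_edges G v.
      lex_order P fst (\<lambda>a b. (a, b) \<in> r \<and> a \<noteq> b) a b \<and>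
      lex_order P fst (\<lambda>a b. x (snd a) < x (snd b)) b a}"
    using assms(2) by (auto simp: lex_order_def half_edges_def)
  show ?thesis unfolding map_sgn_def order_sgn_def eq1 eq2 if_P[OF assms(1)] ..
qed

text \<open>Both orders sort by vertex first and in the same way, so inversions occur only at a
  common vertex.\<close>

lemma colouring_sgn_eq_order_sgn:
  assumes fin: "finite_graph G" and P: "tournament_on (verts G) P"
    and inj: "\<And>v. v \<in> verts G \<Longrightarrow> inj_on (\<lambda>h. x (snd h)) (half_edges G v)"
  shows "colouring_sgn G r x =
     order_sgn (incidences G) (lex_order P fst (\<lambda>a b. (a, b) \<in> r (fst a) \<and> a \<noteq> b))
       (lex_order P fst (\<lambda>a b. x (snd a) < x (snd b)))"
proof -
  let ?R = "lex_order P fst (\<lambda>a b. (a, b) \<in> r (fst a) \<and> a \<noteq> b)"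
  let ?S = "lex_order P fst (\<lambda>a b. x (snd a) < x (snd b))"
  have "order_sgn (incidences G) ?R ?S =
      (\<Prod>v\<in>verts G. order_sgn {h \<in> incidences G. fst h = v} ?R ?S)"
  proof (rule order_sgn_fibres[OF finite_incidences[OF fin]])
    show "finite (verts G)" using fin by (simp add: finite_graph_def)
    show "fst ` incidences G \<subseteq> verts G" by (auto simp: incidences_def)
    fix a b
    assume ab: "a \<in> incidences G" "b \<in> incidences G" "?R a b" "?S b a"
    then have "fst a \<in> verts G" "fst b \<in> verts G" by (auto simp: incidences_def)
    then have "P (fst a) (fst b) \<longleftrightarrow> fst a \<noteq> fst b \<and> \<not> P (fst b) (fst a)"
      by (rule tournament_onD[OF P])
    then show "fst a = fst b" using ab(3,4) unfolding lex_order_def by metis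
  qed
  also have "\<dots> = (\<Prod>v\<in>verts G. map_sgn (half_edges G v) (r v) (\<lambda>(v, e). x e))"
  proof (rule prod.cong[OF refl])
    fix v
    assume v: "v \<in> verts G"
    have "\<not> P v v" using tournament_onD[OF P v v] by simp
    then show "order_sgn {h \<in> incidences G. fst h = v} ?R ?S =
        map_sgn (half_edges G v) (r v) (\<lambda>(v, e). x e)"
      unfolding half_edges_eq_fibre[OF v, symmetric] map_sgn_eq_order_sgn[where P = P, OF inj[OF v] \<open>\<not> P v v\<close>]
      by (intro order_sgn_cong) (auto simp: lex_order_def half_edges_def)
  qed
  finally show ?thesis unfolding colouring_sgn_def by simp
qed

text \<open>This carries orders that are expressed through vertex and colour to a ground set that
  does not mention the colouring.\<close>

lemma bij_betw_vertex_colour: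
  assumes "finite_graph G" "regular k G" "x \<in> proper_edge_colourings G k"
  shows "bij_betw (\<lambda>h. (fst h, x (snd h))) (incidences G) (verts G \<times> {0..<k})"
  unfolding bij_betw_def
proof
  note bij = bij_betw_colours_at_vertex[OF assms]
  show "inj_on (\<lambda>h. (fst h, x (snd h))) (incidences G)"
  proof (rule inj_onI)
    fix a b
    assume ab: "a \<in> incidences G" "b \<in> incidences G" "(fst a, x (snd a)) = (fst b, x (snd b))"
    then have v: "fst a \<in> verts G" by (auto simp: incidences_def)
    have "a \<in> half_edges G (fst a)" "b \<in> half_edges G (fst a)"
      using ab by (auto simp: incidences_def half_edges_def)
    then show "a = b" using bij_betw_imp_inj_on[OF bij[OF v]] ab(3) by (auto dest: inj_onD)
  qed
  show "(\<lambda>h. (fst h, x (snd h))) ` incidences G = verts G \<times> {0..<k}"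
  proof (intro equalityI subsetI)
    fix p
    assume "p \<in> (\<lambda>h. (fst h, x (snd h))) ` incidences G"
    then obtain v e where p: "p = (v, x e)" "(v, e) \<in> half_edges G v" "v \<in> verts G"
      by (auto simp: incidences_def half_edges_def)
    then have "x e \<in> {0..<k}" using bij_betw_apply[OF bij[OF p(3)] p(2)] by simp
    then show "p \<in> verts G \<times> {0..<k}" using p by simp
  next
    fix p
    assume p: "p \<in> verts G \<times> {0..<k}"
    then have "snd p \<in> (\<lambda>h. x (snd h)) ` half_edges G (fst p)"
      using bij[of "fst p"] by (auto simp: bij_betw_def)
    then obtain h where "h \<in> half_edges G (fst p)" "snd p = x (snd h)" by blast
    moreover from this have "fst h = fst p" "h \<in> incidences G"
      using p by (auto simp: half_edges_def incidences_def)
    ultimately show "p \<in> (\<lambda>h. (fst h, x (snd h))) ` incidences G"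
      by (intro image_eqI[of _ _ h]) (simp_all add: prod_eq_iff)
  qed
qed

lemma tournament_on_less: "tournament_on A (\<lambda>a b. (f a :: 'b :: linorder) < f b)" if "inj_on f A"
  using that unfolding tournament_on_def inj_on_def by (metis less_asym less_irrefl linorder_neqE)

text \<open>Between two blocks either all pairs of elements are inverted or none, and the number of
  such pairs is a product of even block sizes.\<close>

lemma order_sgn_paired_blocks:
  assumes fin: "finite A" and Q: "tournament_on B Q" and f: "f ` A \<subseteq> B"
    and even: "\<And>b. b \<in> B \<Longrightarrow> even (card {a \<in> A. f a = b})"
    and P: "tournament_on B P"
    and T: "\<And>b. b \<in> B \<Longrightarrow> tournament_on {a \<in> A. f a = b} T"
  shows "order_sgn A (lex_order P f T) (lex_order Q f T) = 1"
proof -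
  \<comment> \<open>Block indices are drawn from the image of \<open>A\<close>, which is finite,
    while \<open>B\<close> may be infinite.\<close>
  let ?F = "\<lambda>b. {a \<in> A. f a = b}"
  let ?D = "{(b, c) \<in> f ` A \<times> f ` A. P b c \<and> Q c b}"
  have eq: "{(a, b) \<in> A \<times> A. lex_order P f T a b \<and> lex_order Q f T b a} = (\<Union>(b, c)\<in>?D. ?F b \<times> ?F c)"
    (is "?L = ?R")
  proof (intro equalityI subrelI)
    fix a b
    assume "(a, b) \<in> ?L"
    then have ab: "a \<in> A" "b \<in> A" "lex_order P f T a b" "lex_order Q f T b a" by simp_all
    then have B: "f a \<in> B" "f b \<in> B" using f by auto
    have "f a \<noteq> f b"
    proof
      assume eq: "f a = f b"
      then have "T a b" "T b a" using ab(3,4) tournament_onD[OF P B] tournament_onD[OF Q B]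
        by (simp_all add: lex_order_def)
      then show False using tournament_onD[OF T[OF B(2)], of a b] ab eq by simp
    qed
    then have "P (f a) (f b)" "Q (f b) (f a)" using ab(3,4) by (simp_all add: lex_order_def)
    then show "(a, b) \<in> ?R" using ab(1,2) by auto
  next
    fix a b
    assume "(a, b) \<in> ?R"
    then show "(a, b) \<in> ?L" by (auto simp: lex_order_def)
  qed
  have "card ?R = (\<Sum>(b, c)\<in>?D. card (?F b \<times> ?F c))"
    unfolding case_prod_beta
    by (rule card_UN_disjoint) (use fin in \<open>auto intro!: finite_Collect_pairs\<close>)
  also have "even \<dots>"
    by (rule dvd_sum) (use even f in \<open>auto simp: card_cartesian_product\<close>)
  finally have "even (card ?L)" unfolding eq .
  then show ?thesis unfolding order_sgn_def by simp
qed

text \<open>Each vertex meets exactly one edge \<open>m v\<close> of colour \<open>c\<close>, so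
  sending \<open>v\<close> to \<open>(v, m v)\<close> identifies the vertices with the incidences of
  that colour. Under this map the two orders become those whose relative sign is the matching
  sign.\<close>

lemma order_sgn_colour_class:
  assumes G: "finite_graph G" "regular k G" "x \<in> proper_edge_colourings G k"
    and vs: "distinct vs" "set vs = verts G" and c: "c < k"
  obtains es where "distinct es" "set es = colour_class G x c"
    "order_sgn {h \<in> incidences G. x (snd h) = c} (lex_order (<) (\<lambda>h. x (snd h)) (\<lambda>a b. before vs (fst a) (fst b)))
      (lex_order (lex_order (<) x (before es)) snd (\<lambda>a b. before vs (fst a) (fst b)))
     = matching_sgn G vs (colour_class G x c)"
proof -
  let ?M = "colour_class G x c"
  define m where "m v = (THE e. e \<in> ?M \<and> v \<in> ends G e)" for v
  have ex1: "\<exists>!e. e \<in> ?M \<and> v \<in> ends G e" if "v \<in> verts G" for v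
    by (rule ex1_edge_of_colour[OF G that c])
  have m: "m v \<in> ?M \<and> v \<in> ends G (m v)" if "v \<in> verts G" for v
    using theI'[OF ex1[OF that]] unfolding m_def .
  have "finite ?M" using G(1) unfolding finite_graph_def colour_class_def by simp
  from matching_sgn_eq_order_sgn[OF vs perfect_matching_colour_class[OF G c] this m]
  obtain es where es: "distinct es" "set es = ?M"
    "matching_sgn G vs ?M = order_sgn (verts G) (before vs) (lex_order (before es) m (before vs))"
    by blast
  have bij: "bij_betw (\<lambda>v. (v, m v)) (verts G) {h \<in> incidences G. x (snd h) = c}"
  proof (rule bij_betwI[of _ _ _ fst])
    show "(\<lambda>v. (v, m v)) \<in> verts G \<rightarrow> {h \<in> incidences G. x (snd h) = c}"
      using m by (auto simp: incidences_def colour_class_def)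
    show "fst \<in> {h \<in> incidences G. x (snd h) = c} \<rightarrow> verts G"
      by (auto simp: incidences_def)
    fix h
    assume "h \<in> {h \<in> incidences G. x (snd h) = c}"
    then have "fst h \<in> verts G" "snd h \<in> ?M \<and> fst h \<in> ends G (snd h)"
      by (auto simp: incidences_def colour_class_def)
    then have "m (fst h) = snd h" using ex1 m by blast
    then show "(fst h, m (fst h)) = h" by (simp add: prod_eq_iff)
  qed simp
  have "order_sgn {h \<in> incidences G. x (snd h) = c}
      (lex_order (<) (\<lambda>h. x (snd h)) (\<lambda>a b. before vs (fst a) (fst b)))
      (lex_order (lex_order (<) x (before es)) snd (\<lambda>a b. before vs (fst a) (fst b)))
     = order_sgn (verts G) (before vs) (lex_order (before es) m (before vs))"
    unfolding order_sgn_reindex[OF bij, symmetric]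
    by (rule order_sgn_cong) (use m in \<open>auto simp: lex_order_def colour_class_def\<close>)
  then show ?thesis using es that by simp
qed

text \<open>Once \<open>Q\<close> sorts edges by colour, both orders sort by colour first and the
  sign splits over the colour classes. \<open>Q\<close> may depend on the colouring, as the order of
  the edges does not affect the sign.\<close>

lemma lex_order_sgn_mult_matching_sgns:
  assumes G: "finite_graph G" "regular k G" "x \<in> proper_edge_colourings G k"
    and vs: "distinct vs" "set vs = verts G" 
  obtains Q where "tournament_on (edges G) Q"
    "order_sgn (incidences G) (lex_order (<) (\<lambda>h. x (snd h)) (\<lambda>a b. before vs (fst a) (fst b)))
      (lex_order Q snd (\<lambda>a b. before vs (fst a) (fst b)))
     = (\<Prod>c<k. matching_sgn G vs (colour_class G x c))"
proof -
  let ?T = "\<lambda>a b. before vs (fst a) (fst b)"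
  let ?S = "lex_order (<) (\<lambda>h. x (snd h)) ?T"
  have "\<forall>c. \<exists>es. c < k \<longrightarrow> distinct es \<and> set es = colour_class G x c \<and>
    order_sgn {h \<in> incidences G. x (snd h) = c} ?S (lex_order (lex_order (<) x (before es)) snd ?T)
     = matching_sgn G vs (colour_class G x c)"
  proof (intro allI)
    fix c
    show "\<exists>es. c < k \<longrightarrow> distinct es \<and> set es = colour_class G x c \<and>
      order_sgn {h \<in> incidences G. x (snd h) = c} ?S (lex_order (lex_order (<) x (before es)) snd ?T)
       = matching_sgn G vs (colour_class G x c)"
    proof (cases "c < k")
      case True
      show ?thesis by (rule order_sgn_colour_class[OF G vs True]) blast
    qed simp
  qed
  from choice[OF this] obtain es where es: "\<And>c. c < k \<Longrightarrow> distinct (es c)"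
    "\<And>c. c < k \<Longrightarrow> set (es c) = colour_class G x c"
    "\<And>c. c < k \<Longrightarrow> order_sgn {h \<in> incidences G. x (snd h) = c} ?S
       (lex_order (lex_order (<) x (before (es c))) snd ?T) = matching_sgn G vs (colour_class G x c)"
    by blast
  \<comment> \<open>The listing \<open>es (x e)\<close> serves the whole colour class of
    \<open>e\<close>, because the tie-breaker is used only for edges of equal colour.\<close>
  define Q where "Q = lex_order (<) x (\<lambda>e. before (es (x e)) e)"
  have x: "x e < k" if "e \<in> edges G" for e
    using G(3) that unfolding proper_edge_colourings_def by auto
  have Q: "tournament_on (edges G) Q"
    unfolding Q_def
  proof (rule tournament_on_lex_order[of "{..<k}"])
    show "tournament_on {..<k} (<)" by (rule tournament_on_less[of "\<lambda>x. x"]) simp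
    show "x ` edges G \<subseteq> {..<k}" using x by auto
    fix c
    assume "c \<in> {..<k}"
    then have "tournament_on {e \<in> edges G. x e = c} (before (es c))"
      using tournament_on_before es(1,2) by (metis colour_class_def lessThan_iff)
    then show "tournament_on {e \<in> edges G. x e = c} (\<lambda>e. before (es (x e)) e)"
      by (rule tournament_on_cong) simp
  qed
  have "order_sgn (incidences G) ?S (lex_order Q snd ?T) =
     (\<Prod>c<k. order_sgn {h \<in> incidences G. x (snd h) = c} ?S (lex_order Q snd ?T))"
  proof (rule order_sgn_fibres[OF finite_incidences[OF G(1)]])
    show "(\<lambda>h. x (snd h)) ` incidences G \<subseteq> {..<k}" using x by (auto simp: incidences_def)
    fix a b
    assume "?S a b" "lex_order Q snd ?T b a"
    then show "x (snd a) = x (snd b)" by (auto simp: lex_order_def Q_def)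
  qed simp
  also have "\<dots> = (\<Prod>c<k. matching_sgn G vs (colour_class G x c))"
  proof (rule prod.cong[OF refl])
    fix c
    assume "c \<in> {..<k}"
    then have "matching_sgn G vs (colour_class G x c) = order_sgn {h \<in> incidences G. x (snd h) = c} ?S
       (lex_order (lex_order (<) x (before (es c))) snd ?T)"
      using es(3) by simp
    also have "\<dots> = order_sgn {h \<in> incidences G. x (snd h) = c} ?S (lex_order Q snd ?T)"
      by (rule order_sgn_cong) (auto simp: lex_order_def Q_def)
    finally show "order_sgn {h \<in> incidences G. x (snd h) = c} ?S (lex_order Q snd ?T) =
      matching_sgn G vs (colour_class G x c)" by simp
  qed
  finally show ?thesis using Q that by blast
qed

text \<open>Two signs in the chain of orders do not involve the colouring: the one between its ends
  and the one for exchanging vertex and colour. Their product is \<open>K\<close>.\<close>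

lemma colouring_sgn_eq_prod_matching_sgn:
  fixes G :: "('v, 'e) graph"
  assumes G: "finite_graph G" "regular k G" 
    and r: "\<And>v. v \<in> verts G \<Longrightarrow> linear_order_on (half_edges G v) (r v)"
    and vs: "distinct vs" "set vs = verts G"
  obtains K :: int where "\<And>x. x \<in> proper_edge_colourings G k \<Longrightarrow>
    colouring_sgn G r x = K * (\<Prod>c<k. matching_sgn G vs (colour_class G x c))"
proof -
  let ?H = "incidences G"
  let ?P = "before vs"
  let ?T = "\<lambda>a b. before vs (fst a) (fst b)"
  obtain fs where fs: "distinct fs" "set fs = edges G"
    using finite_distinct_list G(1) unfolding finite_graph_def by metis
  (* Between S1 and a colouring-independent order S5 lie S2 (vertex, colour), S3 (colour, vertex)
     and S4 (colour, edge within the colour class, vertex). *)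
  let ?S1 = "lex_order ?P fst (\<lambda>a b. (a, b) \<in> r (fst a) \<and> a \<noteq> b)"
  let ?S5 = "lex_order (before fs) snd ?T"
  let ?C = "order_sgn (verts G \<times> {0..<k}) (lex_order ?P fst (\<lambda>a b. snd a < snd b))
      (lex_order (<) snd ?T)"
  note finH = finite_incidences[OF G(1)]
  have P: "tournament_on (verts G) ?P" using tournament_on_before[OF vs(1)] vs(2) by simp
  have E: "tournament_on (edges G) (before fs)" using tournament_on_before[OF fs(1)] fs(2) by simp
  have fst_V: "fst ` ?H \<subseteq> verts G" and snd_E: "snd ` ?H \<subseteq> edges G" by (auto simp: incidences_def)
  have T: "tournament_on {h \<in> ?H. snd h = e} ?T" for e
    by (rule tournament_on_inj[OF P]) (auto simp: incidences_def inj_on_def)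
  \<comment> \<open>Every edge has exactly two incidences, which makes the order of the edges
    immaterial.\<close>
  have card_fibre: "even (card {h \<in> ?H. snd h = e})" if "e \<in> edges G" for e
  proof -
    have "ends G e \<subseteq> verts G" "card (ends G e) = 2"
      using G(1) that unfolding finite_graph_def by blast+
    then have "{h \<in> ?H. snd h = e} = ends G e \<times> {e}" using that by (auto simp: incidences_def)
    then show ?thesis using \<open>card (ends G e) = 2\<close> by (simp add: card_cartesian_product)
  qed
  have t1: "tournament_on ?H ?S1"
  proof (rule tournament_on_lex_order[OF P fst_V])
    fix v
    assume v: "v \<in> verts G"
    have "total_on (half_edges G v) (r v)" "antisym (r v)"
      using r[OF v] unfolding linear_order_on_def partial_order_on_def by blast+
    then have "((a, b) \<in> r v) \<noteq> ((b, a) \<in> r v)"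
      if "a \<in> half_edges G v" "b \<in> half_edges G v" "a \<noteq> b" for a b
      using that unfolding total_on_def antisym_def by blast
    then have "tournament_on (half_edges G v) (\<lambda>a b. (a, b) \<in> r v \<and> a \<noteq> b)"
      unfolding tournament_on_def by blast
    then show "tournament_on {h \<in> ?H. fst h = v} (\<lambda>a b. (a, b) \<in> r (fst a) \<and> a \<noteq> b)"
      unfolding half_edges_eq_fibre[OF v] by (rule tournament_on_cong) auto
  qed
  have t5: "tournament_on ?H ?S5" by (rule tournament_on_lex_order[OF E snd_E T])
  show ?thesis
  proof (rule that[of "order_sgn ?H ?S1 ?S5 * ?C"])
    fix x
    assume x: "x \<in> proper_edge_colourings G k"
    note Gx = G x
    let ?S2 = "lex_order ?P fst (\<lambda>a b. x (snd a) < x (snd b))"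
    let ?S3 = "lex_order (<) (\<lambda>h. x (snd h)) ?T"
    obtain Q where Q: "tournament_on (edges G) Q"
      "order_sgn ?H ?S3 (lex_order Q snd ?T) = (\<Prod>c<k. matching_sgn G vs (colour_class G x c))"
      using lex_order_sgn_mult_matching_sgns[OF Gx vs] by blast
    let ?S4 = "lex_order Q snd ?T"
    let ?\<Pi> = "\<Prod>c<k. matching_sgn G vs (colour_class G x c)"
    have inj: "inj_on (\<lambda>h. x (snd h)) (half_edges G v)" if "v \<in> verts G" for v
      using bij_betw_imp_inj_on[OF bij_betw_colours_at_vertex[OF Gx that]] .
    have t2: "tournament_on ?H ?S2"
    proof (rule tournament_on_lex_order[OF P fst_V])
      fix v
      assume v: "v \<in> verts G"
      show "tournament_on {h \<in> ?H. fst h = v} (\<lambda>a b. x (snd a) < x (snd b))"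
        unfolding half_edges_eq_fibre[OF v, symmetric] by (rule tournament_on_less[OF inj[OF v]])
    qed
    have t3: "tournament_on ?H ?S3"
    proof (rule tournament_on_lex_order)
      show "tournament_on UNIV ((<) :: nat \<Rightarrow> _)" by (rule tournament_on_less[of "\<lambda>x. x"]) simp
      fix c
      have "inj_on (\<lambda>h. (fst h, x (snd h))) ?H"
        by (rule bij_betw_imp_inj_on[OF bij_betw_vertex_colour[OF Gx]])
      then show "tournament_on {h \<in> ?H. x (snd h) = c} ?T"
        using fst_V by (intro tournament_on_inj[OF P]) (auto simp: inj_on_def)
    qed simp
    have t4: "tournament_on ?H ?S4" by (rule tournament_on_lex_order[OF Q(1) snd_E T])
    have s12: "order_sgn ?H ?S1 ?S2 = colouring_sgn G r x"
      using colouring_sgn_eq_order_sgn[OF G(1) P inj] by simp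
    have s23: "order_sgn ?H ?S2 ?S3 = ?C"
      unfolding order_sgn_reindex[OF bij_betw_vertex_colour[OF Gx], symmetric]
      by (rule order_sgn_cong) (simp_all add: lex_order_def)
    have s45: "order_sgn ?H ?S4 ?S5 = 1"
      by (rule order_sgn_paired_blocks[OF finH E snd_E card_fibre Q(1) T])
    have "order_sgn ?H ?S1 ?S2 * order_sgn ?H ?S2 ?S3 * order_sgn ?H ?S3 ?S4 * order_sgn ?H ?S4 ?S5
        = order_sgn ?H ?S1 ?S5"
      unfolding order_sgn_trans[OF finH t1 t2 t3] order_sgn_trans[OF finH t1 t3 t4]
        order_sgn_trans[OF finH t1 t4 t5] ..
    then have "colouring_sgn G r x * ?C * ?\<Pi> = order_sgn ?H ?S1 ?S5"
      unfolding s12 s23 s45 Q(2) by simp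
    \<comment> \<open>All factors are signs and hence their own inverses, so the relation can be
      solved for \<open>colouring_sgn G r x\<close>.\<close>
    then have "order_sgn ?H ?S1 ?S5 * ?C * ?\<Pi> = colouring_sgn G r x * ?C * ?\<Pi> * ?C * ?\<Pi>"
      by (simp only:)
    also have "\<dots> = colouring_sgn G r x * (?C * ?C) * (?\<Pi> * ?\<Pi>)"
      by (simp only: mult.assoc mult.left_commute)
    also have "\<dots> = colouring_sgn G r x"
      unfolding Q(2)[symmetric] order_sgn_sq by simp
    finally show "colouring_sgn G r x = order_sgn ?H ?S1 ?S5 * ?C * ?\<Pi>" ..
  qed
qed

section \<open>Constancy of the sign under a Pfaffian labelling\<close>

text \<open>Replacing -1 by \<open>z\<close> respects products because \<open>z\<close> squares to
  the unit. The second claim travels through the same induction, since testing for 1 identifies the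
  product only if it is known to be a sign.\<close>

lemma (in comm_group) finprod_sign:
  assumes "z \<in> carrier G" "z \<otimes> z = \<one>" "z \<noteq> \<one>" "finite I"
    and s: "\<And>i. i \<in> I \<Longrightarrow> s i = 1 \<or> s i = (-1 :: int)"
  shows "finprod G (\<lambda>i. if s i = 1 then \<one> else z) I = (if prod s I = 1 then \<one> else z)"
    and "prod s I = 1 \<or> prod s I = -1"
proof -
  have "finprod G (\<lambda>i. if s i = 1 then \<one> else z) I = (if prod s I = 1 then \<one> else z) \<and>
      (prod s I = 1 \<or> prod s I = -1)"
    using assms(4) s
  proof (induction I rule: finite_induct)
    case empty
    show ?case by simp
  next
    case (insert i I)
    then have IH: "finprod G (\<lambda>i. if s i = 1 then \<one> else z) I = (if prod s I = 1 then \<one> else z)"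
      "prod s I = 1 \<or> prod s I = -1" and si: "s i = 1 \<or> s i = -1" by simp_all
    have "finprod G (\<lambda>i. if s i = 1 then \<one> else z) (insert i I) =
        (if s i = 1 then \<one> else z) \<otimes> (if prod s I = 1 then \<one> else z)"
      unfolding IH(1)[symmetric] using insert.hyps assms(1) by (intro finprod_insert) auto
    moreover have "prod s (insert i I) = s i * prod s I" using insert.hyps by simp
    ultimately show ?case using si IH(2) assms(1,2) by auto
  qed
  then show "finprod G (\<lambda>i. if s i = 1 then \<one> else z) I = (if prod s I = 1 then \<one> else z)"
    and "prod s I = 1 \<or> prod s I = -1" by blast+
qed

text \<open>The Pfaffian identity compares the classes of the same colour in \<open>x\<close> and
  \<open>x'\<close>. Multiplied over all colours it contains the same product of labels on both
  sides.\<close>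

lemma prod_matching_sgn_eq:
  fixes \<Gamma> :: "('g, 'm) monoid_scheme"
  assumes G: "finite_graph G" "regular k G"
    and pf: "pfaffian_labelling G \<Gamma> z vs l"
    and x: "x \<in> proper_edge_colourings G k" and x': "x' \<in> proper_edge_colourings G k"
  shows "(\<Prod>c<k. matching_sgn G vs (colour_class G x c)) = (\<Prod>c<k. matching_sgn G vs (colour_class G x' c))"
proof -
  interpret comm_group \<Gamma> using pf unfolding pfaffian_labelling_def by blast
  have z: "z \<in> carrier \<Gamma>" "ord z = 2" and l: "l \<in> edges G \<rightarrow> carrier \<Gamma>"
    using pf unfolding pfaffian_labelling_def by blast+
  have zz: "z \<otimes>\<^bsub>\<Gamma>\<^esub> z = \<one>\<^bsub>\<Gamma>\<^esub>"
    using pow_ord_eq_1[OF z(1)] z by (simp add: numeral_2_eq_2)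
  have z1: "z \<noteq> \<one>\<^bsub>\<Gamma>\<^esub>" using ord_eq_1[OF z(1)] z(2) by simp
  define s where "s M = (if matching_sgn G vs M = 1 then \<one>\<^bsub>\<Gamma>\<^esub> else z)" for M
  have s: "s M \<in> carrier \<Gamma>" for M unfolding s_def using z by simp
  have const: "s M \<otimes>\<^bsub>\<Gamma>\<^esub> finprod \<Gamma> l M = s M' \<otimes>\<^bsub>\<Gamma>\<^esub> finprod \<Gamma> l M'"
    if "perfect_matching G M" "perfect_matching G M'" for M M'
    using pf that unfolding pfaffian_labelling_def s_def by blast
  have lM: "finprod \<Gamma> l (colour_class G y c) \<in> carrier \<Gamma>" for y c
    using l by (intro finprod_closed) (auto simp: colour_class_def)
  let ?s = "\<lambda>y. if (\<Prod>c<k. matching_sgn G vs (colour_class G y c)) = 1 then \<one>\<^bsub>\<Gamma>\<^esub> else z"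
  have eq: "finprod \<Gamma> (\<lambda>c. s (colour_class G y c) \<otimes>\<^bsub>\<Gamma>\<^esub> finprod \<Gamma> l (colour_class G y c)) {..<k}
      = ?s y \<otimes>\<^bsub>\<Gamma>\<^esub> finprod \<Gamma> l (edges G)"
    if y: "y \<in> proper_edge_colourings G k" for y
  proof -
    have "y e < k" if "e \<in> edges G" for e
      using y that unfolding proper_edge_colourings_def by auto
    then have "edges G = (\<Union>c\<in>{..<k}. colour_class G y c)"
      unfolding colour_class_def by auto
    moreover have "finprod \<Gamma> l (\<Union>c\<in>{..<k}. colour_class G y c) =
        finprod \<Gamma> (\<lambda>c. finprod \<Gamma> l (colour_class G y c)) {..<k}"
      by (rule finprod_UN_disjoint)
        (use l G(1) in \<open>auto simp: colour_class_def finite_graph_def pairwise_def disjnt_def\<close>)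
    ultimately have edges: "finprod \<Gamma> l (edges G) = finprod \<Gamma> (\<lambda>c. finprod \<Gamma> l (colour_class G y c)) {..<k}"
      by (simp only:)
    have "finprod \<Gamma> (\<lambda>c. s (colour_class G y c)) {..<k} = ?s y"
      unfolding s_def
      by (rule finprod_sign(1)[OF z(1) zz z1 finite_lessThan matching_sgn_cases])
    then show ?thesis
      unfolding edges by (subst finprod_multf) (use s lM in auto)
  qed
  have "finprod \<Gamma> (\<lambda>c. s (colour_class G x c) \<otimes>\<^bsub>\<Gamma>\<^esub> finprod \<Gamma> l (colour_class G x c)) {..<k}
      = finprod \<Gamma> (\<lambda>c. s (colour_class G x' c) \<otimes>\<^bsub>\<Gamma>\<^esub> finprod \<Gamma> l (colour_class G x' c)) {..<k}"
  proof (rule finprod_cong'[OF refl])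
    fix c
    assume "c \<in> {..<k}"
    then show "s (colour_class G x c) \<otimes>\<^bsub>\<Gamma>\<^esub> finprod \<Gamma> l (colour_class G x c)
      = s (colour_class G x' c) \<otimes>\<^bsub>\<Gamma>\<^esub> finprod \<Gamma> l (colour_class G x' c)"
      using perfect_matching_colour_class[OF G] x x' by (intro const) simp_all
  qed (use s lM in auto)
  then have "?s x \<otimes>\<^bsub>\<Gamma>\<^esub> finprod \<Gamma> l (edges G) = ?s x' \<otimes>\<^bsub>\<Gamma>\<^esub> finprod \<Gamma> l (edges G)"
    unfolding eq[OF x] eq[OF x'] .
  \<comment> \<open>Cancelling the labels leaves the signs, still as elements of
    \<open>\<Gamma>\<close>.\<close>
  then have eq_s: "?s x = ?s x'"
    using z l by (subst (asm) right_cancel) (simp_all add: finprod_closed)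
  have pm: "(\<Prod>c<k. matching_sgn G vs (colour_class G y c)) = 1 \<or>
      (\<Prod>c<k. matching_sgn G vs (colour_class G y c)) = -1" for y
    by (rule finprod_sign(2)[OF z(1) zz z1 finite_lessThan matching_sgn_cases])
  \<comment> \<open>As \<open>z\<close> differs from the unit, the element of
    \<open>\<Gamma>\<close> determines the integer sign.\<close>
  show ?thesis using eq_s z1 pm[of x] pm[of x'] by (auto split: if_splits)
qed

lemma colouring_sgn_eq_const:
  assumes G: "finite_graph G" "regular k G"
    and pf: "pfaffian_labelling G \<Gamma> z vs l"
    and r: "\<And>v. v \<in> verts G \<Longrightarrow> linear_order_on (half_edges G v) (r v)"
    and x: "x \<in> proper_edge_colourings G k" and x': "x' \<in> proper_edge_colourings G k"
  shows "colouring_sgn G r x = colouring_sgn G r x'"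
proof -
  have vs: "distinct vs" "set vs = verts G" using pf unfolding pfaffian_labelling_def by blast+
  obtain K where "\<And>x. x \<in> proper_edge_colourings G k \<Longrightarrow>
      colouring_sgn G r x = K * (\<Prod>c<k. matching_sgn G vs (colour_class G x c))"
    using colouring_sgn_eq_prod_matching_sgn[where r = r, OF G r vs] by blast
  then show ?thesis using prod_matching_sgn_eq[OF G pf x x'] x x' by simp
qed

section \<open>An orthogonal change of basis\<close>

text \<open>The signs prescribed for the last column are the cofactor signs along it, so that they
  cancel when the minors are computed. A reflection suffices because only this one column is
  prescribed.\<close>

lemma orthogonal_matrix_last_column:
  assumes "1 \<le> k"
  obtains Q :: "nat \<Rightarrow> nat \<Rightarrow> real" where
    "\<And>a b. a \<le> k \<Longrightarrow> b \<le> k \<Longrightarrow> (\<Sum>i\<le>k. Q i a * Q i b) = (if a = b then 1 else 0)"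
    "\<And>j. j \<le> k \<Longrightarrow> Q j k = (-1) ^ (j + k) / sqrt (real (k + 1))"
proof -
  (* Householder reflection exchanging the unit vectors w and e. *)
  define w where "w j = (-1) ^ (j + k) / sqrt (real (k + 1))" for j
  define e where "e j = (if j = k then 1 else 0 :: real)" for j
  define u where "u j = w j - e j" for j
  \<comment> \<open>This is 2 divided by the squared length of \<open>u\<close>, see
    \<open>uu\<close>; \<open>1 \<le> k\<close> makes the denominator positive.\<close>
  define c where "c = 1 / (1 - w k)"
  define Q where "Q i j = (if i = j then 1 else 0) - c * u i * u j" for i j
  have "w k = 1 / sqrt (real (k + 1))" unfolding w_def by (simp add: mult_2[symmetric])
  moreover have "sqrt (real (k + 1)) > 1" using assms by simp
  ultimately have wk: "w k < 1" by simp
  then have c: "c * (1 - w k) = 1" unfolding c_def by simp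
  have "w j * w j = 1 / real (k + 1)" for j
  proof -
    have "w j * w j = ((-1) ^ (j + k) * (-1) ^ (j + k)) / (sqrt (real (k + 1)) * sqrt (real (k + 1)))"
      unfolding w_def by simp
    then show ?thesis by (simp add: power_add[symmetric] mult_2[symmetric])
  qed
  then have ww: "(\<Sum>i\<le>k. w i * w i) = 1" by simp
  have "(\<Sum>i\<le>k. u i * u i) = (\<Sum>i\<le>k. w i * w i) - 2 * (\<Sum>i\<le>k. e i * w i) + (\<Sum>i\<le>k. e i * e i)"
    unfolding u_def by (simp add: algebra_simps sum.distrib sum_subtractf sum_distrib_left)
  also have "\<dots> = 2 * (1 - w k)" unfolding ww by (simp add: e_def if_distrib[of "\<lambda>x. x * _"] cong: if_cong)
  finally have uu: "(\<Sum>i\<le>k. u i * u i) = 2 * (1 - w k)" .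
  have "(\<Sum>i\<le>k. Q i a * Q i b) = (if a = b then 1 else 0)" if ab: "a \<le> k" "b \<le> k" for a b
  proof -
    have "(\<Sum>i\<le>k. Q i a * Q i b) = (\<Sum>i\<le>k. (if i = a then (if a = b then 1 else 0) else 0)
       - (if i = a then c * u i * u b else 0) - (if i = b then c * u i * u a else 0)
       + c * c * u a * u b * (u i * u i))"
      unfolding Q_def by (intro sum.cong refl) (auto simp: algebra_simps)
    also have "\<dots> = (if a = b then 1 else 0) - c * u a * u b - c * u b * u a
       + c * c * u a * u b * (\<Sum>i\<le>k. u i * u i)"
      using ab by (simp add: sum.distrib sum_subtractf sum_distrib_left)
    also have "c * c * u a * u b * (\<Sum>i\<le>k. u i * u i) = 2 * c * u a * u b * (c * (1 - w k))"
      unfolding uu by simp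
    finally show ?thesis unfolding c by simp
  qed
  \<comment> \<open>Since \<open>u k\<close> is \<open>w k - 1\<close>, the reflection adds exactly
    \<open>u\<close> to the last basis vector and thus yields \<open>w\<close>.\<close>
  moreover have "Q j k = w j" for j
  proof -
    have "Q j k = e j + u j * (c * (1 - w k))"
      unfolding Q_def u_def[of k] by (simp add: e_def algebra_simps)
    then show ?thesis unfolding c u_def by simp
  qed
  ultimately show ?thesis using that unfolding w_def by blast
qed

text \<open>For an orthogonal matrix the adjugate is the determinant times the transpose, so the
  cofactor at \<open>(j, k)\<close> is \<open>\<delta> * Q j k\<close> and its sign factor cancels
  the one in \<open>Q j k\<close>. The index \<open>if i < j then i else Suc i\<close> runs through
  the rows other than \<open>j\<close>, and only columns below \<open>k\<close> are kept.\<close>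

lemma orthogonal_matrix_minors:
  assumes "1 \<le> k"
  obtains Q :: "nat \<Rightarrow> nat \<Rightarrow> real" and \<delta> :: real where
    "\<And>a b. a \<le> k \<Longrightarrow> b \<le> k \<Longrightarrow> (\<Sum>i\<le>k. Q i a * Q i b) = (if a = b then 1 else 0)"
    "\<delta> = 1 \<or> \<delta> = -1"
    "\<And>j. j \<le> k \<Longrightarrow> det (mat k k (\<lambda>(i, i'). Q (if i < j then i else Suc i) i')) = \<delta> / sqrt (real (k + 1))"
proof -
  obtain Q :: "nat \<Rightarrow> nat \<Rightarrow> real" where
    orth: "\<And>a b. a \<le> k \<Longrightarrow> b \<le> k \<Longrightarrow> (\<Sum>i\<le>k. Q i a * Q i b) = (if a = b then 1 else 0)" and
    col: "\<And>j. j \<le> k \<Longrightarrow> Q j k = (-1) ^ (j + k) / sqrt (real (k + 1))"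
    using orthogonal_matrix_last_column[OF assms] by blast
  define A where "A = mat (Suc k) (Suc k) (\<lambda>(i, j). Q i j)"
  have A: "A \<in> carrier_mat (Suc k) (Suc k)" and At: "transpose_mat A \<in> carrier_mat (Suc k) (Suc k)"
    unfolding A_def by simp_all
  have AtA: "transpose_mat A * A = 1\<^sub>m (Suc k)"
  proof (rule eq_matI)
    fix i j
    assume "i < dim_row (1\<^sub>m (Suc k) :: real mat)" "j < dim_col (1\<^sub>m (Suc k) :: real mat)"
    then have ij: "i \<le> k" "j \<le> k" by simp_all
    have "(transpose_mat A * A) $$ (i, j) = (\<Sum>l\<in>{0..<Suc k}. Q l i * Q l j)"
      using ij unfolding A_def by (simp add: scalar_prod_def)
    also have "{0..<Suc k} = {..k}" by auto
    finally show "(transpose_mat A * A) $$ (i, j) = 1\<^sub>m (Suc k) $$ (i, j)"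
      using ij by (simp add: orth)
  qed (simp_all add: A_def)
  define \<delta> where "\<delta> = det A"
  have "\<delta> * \<delta> = 1"
    using det_mult[OF At A] unfolding AtA det_transpose[OF A] by (simp add: \<delta>_def)
  then have \<delta>: "\<delta> = 1 \<or> \<delta> = -1" by (rule square_eq_1_iff[THEN iffD1])
  have AAt: "A * transpose_mat A = 1\<^sub>m (Suc k)"
    by (rule mat_mult_left_right_inverse[OF At A AtA])
  have "adj_mat A = adj_mat A * (A * transpose_mat A)"
    unfolding AAt using adj_mat(1)[OF A] by simp
  also have "\<dots> = (adj_mat A * A) * transpose_mat A"
    using adj_mat(1)[OF A] A At by simp
  also have "\<dots> = \<delta> \<cdot>\<^sub>m transpose_mat A"
    unfolding adj_mat(3)[OF A] \<delta>_def mult_smult_assoc_mat[OF one_carrier_mat At] using At by simp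
  finally have adj: "adj_mat A = \<delta> \<cdot>\<^sub>m transpose_mat A" .
  have "det (mat k k (\<lambda>(i, i'). Q (if i < j then i else Suc i) i')) = \<delta> / sqrt (real (k + 1))"
    if j: "j \<le> k" for j
  proof -
    have "mat k k (\<lambda>(i, i'). Q (if i < j then i else Suc i) i') = mat_delete A j k"
      by (rule eq_matI) (use j in \<open>auto simp: mat_delete_def A_def\<close>)
    moreover have "cofactor A j k = \<delta> * Q j k"
    proof -
      have "adj_mat A $$ (k, j) = cofactor A j k" using j A by (simp add: adj_mat_def)
      moreover have "(\<delta> \<cdot>\<^sub>m transpose_mat A) $$ (k, j) = \<delta> * Q j k" using j by (simp add: A_def)
      ultimately show ?thesis unfolding adj by simp
    qed
    then have "(-1) ^ (j + k) * ((-1) ^ (j + k) * det (mat_delete A j k)) =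
        (-1) ^ (j + k) * (\<delta> * ((-1) ^ (j + k) / sqrt (real (k + 1))))"
      unfolding cofactor_def col[OF j] by simp
    then have "det (mat_delete A j k) = \<delta> / sqrt (real (k + 1))"
      by (cases "even (j + k)") (simp_all add: mult.assoc[symmetric] power_add[symmetric])
    ultimately show ?thesis by simp
  qed
  then show ?thesis using that orth \<delta> by blast
qed

section \<open>Vertex tensors as determinants\<close>

text \<open>A repeated value of \<open>f\<close> gives two equal rows. Otherwise \<open>f\<close>
  omits exactly one of the \<open>k + 1\<close> row indices, and the matrix is the minor without
  that row, up to a permutation of its rows.\<close>

lemma det_rows_of_colouring:
  fixes Q :: "nat \<Rightarrow> nat \<Rightarrow> real"
  assumes minors: "\<And>j. j \<le> k \<Longrightarrow> det (mat k k (\<lambda>(i, i'). Q (if i < j then i else Suc i) i')) = d"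
    and f: "\<And>i. i < k \<Longrightarrow> f i \<le> k"
  shows "det (mat k k (\<lambda>(i, j). Q (f i) j)) =
    (if inj_on f {0..<k} then real_of_int (order_sgn {0..<k} (<) (\<lambda>i j. f i < f j)) * d else 0)"
proof (cases "inj_on f {0..<k}")
  case False
  then obtain i j where ij: "i < k" "j < k" "i \<noteq> j" "f i = f j" unfolding inj_on_def by auto
  have "det (mat k k (\<lambda>(i, j). Q (f i) j)) = 0"
    by (rule det_identical_rows[of _ k i j]) (use ij in \<open>auto intro!: eq_vecI\<close>)
  then show ?thesis using False by simp
next
  case inj: True
  have "card (f ` {0..<k}) < card {..k}" using card_image[OF inj] by simp
  then have "\<not> {..k} \<subseteq> f ` {0..<k}" by (metis card_mono finite_atLeastLessThan finite_imageI leD)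
  then obtain j where j: "j \<le> k" "j \<notin> f ` {0..<k}" by auto
  \<comment> \<open>Closing the gap at \<open>j\<close> preserves the order of the values, hence the
    sign. Outside the index range \<open>p\<close> is the identity, as \<open>permutes\<close>
    demands.\<close>
  define p where "p i = (if i < k then (if f i < j then f i else f i - 1) else i)" for i
  have fj: "f i \<noteq> j" if "i < k" for i using j(2) that by auto
  have p_less: "p i < k" if "i < k" for i
    using f[OF that] fj[OF that] j(1) that unfolding p_def by auto
  have p_mono: "p a < p b \<longleftrightarrow> f a < f b" if "a < k" "b < k" for a b
    using fj[OF that(1)] fj[OF that(2)] that unfolding p_def by auto
  have "inj_on p {0..<k}"
  proof (rule inj_onI)
    fix a b
    assume ab: "a \<in> {0..<k}" "b \<in> {0..<k}" "p a = p b"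
    then have "f a = f b" using p_mono[of a b] p_mono[of b a] by auto
    then show "a = b" using inj ab by (auto dest: inj_onD)
  qed
  moreover have "p ` {0..<k} \<subseteq> {0..<k}" using p_less by auto
  ultimately have "bij_betw p {0..<k} {0..<k}"
    by (simp add: bij_betw_def endo_inj_surj)
  then have p: "p permutes {0..<k}" by (rule bij_imp_permutes) (simp add: p_def)
  have "tournament_on {0..<k} (<)" by (rule tournament_on_less[of "\<lambda>x. x"]) simp
  then have "order_sgn {0..<k} (<) (\<lambda>a b. p a < p b) = sign p"
    by (intro order_sgn_permutes[OF p]) simp_all
  moreover have "order_sgn {0..<k} (<) (\<lambda>a b. p a < p b) = order_sgn {0..<k} (<) (\<lambda>i j. f i < f j)"
    by (rule order_sgn_cong) (simp_all add: p_mono)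
  ultimately have sign: "order_sgn {0..<k} (<) (\<lambda>i j. f i < f j) = sign p" by simp
  let ?B = "mat k k (\<lambda>(i, i'). Q (if i < j then i else Suc i) i')"
  have "mat k k (\<lambda>(i, j). Q (f i) j) = mat k k (\<lambda>(i, j). ?B $$ (p i, j))"
  proof (rule eq_matI)
    fix a b
    assume "a < dim_row (mat k k (\<lambda>(i, j). ?B $$ (p i, j)))" "b < dim_col (mat k k (\<lambda>(i, j). ?B $$ (p i, j)))"
    then have ab: "a < k" "b < k" by simp_all
    have "(if p a < j then p a else Suc (p a)) = f a"
      using ab fj[OF ab(1)] unfolding p_def by auto
    then show "mat k k (\<lambda>(i, j). Q (f i) j) $$ (a, b) = mat k k (\<lambda>(i, j). ?B $$ (p i, j)) $$ (a, b)"
      using ab p_less[OF ab(1)] by simp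
  qed simp_all
  then have "det (mat k k (\<lambda>(i, j). Q (f i) j)) = of_int (sign p) * det ?B"
    using det_permute_rows[of ?B k p] p by simp
  then show ?thesis unfolding minors[OF j(1)] sign using inj by simp
qed

text \<open>The rank of an element is the number of its strict predecessors, and \<open>h\<close>
  inverts the rank. This turns the order of the half-edges at a vertex into the order of matrix
  rows.\<close>

lemma linear_order_enumeration:
  assumes "finite A" "linear_order_on A r"
  obtains h where "bij_betw h {0..<card A} A"
    "\<And>i j. i < card A \<Longrightarrow> j < card A \<Longrightarrow> (h i, h j) \<in> r \<and> h i \<noteq> h j \<longleftrightarrow> i < j"
proof -
  define rank where "rank a = card {b \<in> A. (b, a) \<in> r \<and> b \<noteq> a}" for a
  have r: "trans r" "antisym r" "total_on A r"
    using assms(2) unfolding linear_order_on_def partial_order_on_def preorder_on_def by blast+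
  have mono: "rank a < rank b" if ab: "a \<in> A" "b \<in> A" "(a, b) \<in> r" "a \<noteq> b" for a b
    unfolding rank_def
  proof (rule psubset_card_mono)
    have "(c, b) \<in> r \<and> c \<noteq> b" if "(c, a) \<in> r" "c \<noteq> a" for c
      using that ab r(1,2) unfolding trans_def antisym_def by blast
    moreover have "a \<in> {c \<in> A. (c, b) \<in> r \<and> c \<noteq> b}" "a \<notin> {c \<in> A. (c, a) \<in> r \<and> c \<noteq> a}"
      using ab by simp_all
    ultimately show "{c \<in> A. (c, a) \<in> r \<and> c \<noteq> a} \<subset> {c \<in> A. (c, b) \<in> r \<and> c \<noteq> b}" by blast
  qed (use assms(1) in simp)
  have iff: "(a, b) \<in> r \<and> a \<noteq> b \<longleftrightarrow> rank a < rank b" if "a \<in> A" "b \<in> A" for a b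
  proof
    assume less: "rank a < rank b"
    then have "a \<noteq> b" by auto
    moreover have "\<not> ((b, a) \<in> r \<and> b \<noteq> a)" using mono[OF that(2,1)] less by auto
    ultimately show "(a, b) \<in> r \<and> a \<noteq> b" using r(3) that unfolding total_on_def by blast
  qed (use mono that in blast)
  have inj: "inj_on rank A"
  proof (rule inj_onI)
    fix a b
    assume ab: "a \<in> A" "b \<in> A" "rank a = rank b"
    then show "a = b" using iff[OF ab(1,2)] iff[OF ab(2,1)] r(3) unfolding total_on_def by auto
  qed
  have "rank a < card A" if "a \<in> A" for a
    unfolding rank_def by (rule psubset_card_mono) (use assms(1) that in auto)
  then have "rank ` A = {0..<card A}"
    by (intro card_subset_eq) (auto simp: card_image[OF inj])
  then have bij: "bij_betw rank A {0..<card A}" using inj unfolding bij_betw_def by simp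
  show ?thesis
  proof (rule that)
    show bij': "bij_betw (inv_into A rank) {0..<card A} A" by (rule bij_betw_inv_into[OF bij])
    fix i j
    assume "i < card A" "j < card A"
    then have "inv_into A rank i \<in> A" "inv_into A rank j \<in> A"
      "rank (inv_into A rank i) = i" "rank (inv_into A rank j) = j"
      using bij bij_betw_apply[OF bij'] bij_betw_inv_into_right[OF bij] by auto
    then show "(inv_into A rank i, inv_into A rank j) \<in> r \<and> inv_into A rank i \<noteq> inv_into A rank j \<longleftrightarrow> i < j"
      using iff by simp
  qed
qed

lemma map_sgn_enumeration:
  assumes bij: "bij_betw h {0..<k} A"
    and h: "\<And>i j. i < k \<Longrightarrow> j < k \<Longrightarrow> (h i, h j) \<in> r \<and> h i \<noteq> h j \<longleftrightarrow> i < j"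
  shows "map_sgn A r \<beta> = (if inj_on (\<lambda>i. \<beta> (h i)) {0..<k}
    then order_sgn {0..<k} (<) (\<lambda>i j. \<beta> (h i) < \<beta> (h j)) else 0)"
proof -
  have "inj_on (\<lambda>i. \<beta> (h i)) {0..<k} \<longleftrightarrow> inj_on \<beta> A"
    using comp_inj_on_iff[of h "{0..<k}" \<beta>] bij unfolding bij_betw_def comp_def by auto
  moreover have "order_sgn {0..<k} (<) (\<lambda>i j. \<beta> (h i) < \<beta> (h j)) =
      order_sgn A (\<lambda>a b. (a, b) \<in> r \<and> a \<noteq> b) (\<lambda>a b. \<beta> a < \<beta> b)"
    unfolding order_sgn_reindex[OF bij, symmetric] by (rule order_sgn_cong) (simp_all add: h)
  ultimately show ?thesis unfolding map_sgn_def order_sgn_def by simp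
qed

text \<open>Functions \<open>z\<close> that are not injective have sign 0, and the injective ones
  correspond to permutations of \<open>{0..<k}\<close>; what remains is the Leibniz formula.\<close>

lemma sum_map_sgn_eq_det:
  fixes B :: "'a \<Rightarrow> nat \<Rightarrow> real"
  assumes bij: "bij_betw h {0..<k} A"
    and h: "\<And>i j. i < k \<Longrightarrow> j < k \<Longrightarrow> (h i, h j) \<in> r \<and> h i \<noteq> h j \<longleftrightarrow> i < j"
  shows "(\<Sum>z\<in>A \<rightarrow>\<^sub>E {0..<k}. real_of_int (map_sgn A r z) * (\<Prod>a\<in>A. B a (z a))) =
    det (mat k k (\<lambda>(i, j). B (h i) j))"
proof -
  let ?g = "inv_into {0..<k} h"
  have h_in: "h i \<in> A" if "i < k" for i using bij_betw_apply[OF bij] that by simp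
  have gh: "?g (h i) = i" if "i < k" for i using bij_betw_inv_into_left[OF bij] that by simp
  have hg: "h (?g a) = a" "?g a < k" if "a \<in> A" for a
    using bij_betw_inv_into_right[OF bij that] bij_betw_apply[OF bij_betw_inv_into[OF bij] that] by simp_all
  have fin: "finite A" using bij_betw_finite[OF bij] by simp
  have inj_iff: "inj_on (\<lambda>i. z (h i)) {0..<k} \<longleftrightarrow> inj_on z A" for z :: "'a \<Rightarrow> nat"
    using comp_inj_on_iff[of h "{0..<k}" z] bij unfolding bij_betw_def comp_def by auto
  have "(\<Sum>z\<in>A \<rightarrow>\<^sub>E {0..<k}. real_of_int (map_sgn A r z) * (\<Prod>a\<in>A. B a (z a))) =
     (\<Sum>z\<in>{z \<in> A \<rightarrow>\<^sub>E {0..<k}. inj_on z A}. real_of_int (map_sgn A r z) * (\<Prod>a\<in>A. B a (z a)))"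
    by (rule sum.mono_neutral_right) (use fin in \<open>auto simp: map_sgn_def finite_PiE\<close>)
  also have "\<dots> = (\<Sum>p\<in>{p. p permutes {0..<k}}. of_int (sign p) * (\<Prod>i = 0..<k. B (h i) (p i)))"
  \<comment> \<open>The witnesses must respect default values: a function in \<open>PiE\<close> is
    \<open>undefined\<close> outside \<open>A\<close>, whereas a permutation fixes every number from
    \<open>k\<close> on.\<close>
  proof (rule sum.reindex_bij_witness[of _ "\<lambda>p. restrict (\<lambda>a. p (?g a)) A"
        "\<lambda>z i. if i < k then z (h i) else i"])
    fix z
    assume "z \<in> {z \<in> A \<rightarrow>\<^sub>E {0..<k}. inj_on z A}"
    then have z: "z \<in> A \<rightarrow>\<^sub>E {0..<k}" "inj_on z A" by simp_all
    let ?p = "\<lambda>i. if i < k then z (h i) else i"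
    show "(\<lambda>a\<in>A. ?p (?g a)) = z"
      by (rule extensionalityI[of _ A]) (use z hg in \<open>auto simp: PiE_def\<close>)
    have "inj_on ?p {0..<k} \<longleftrightarrow> inj_on (\<lambda>i. z (h i)) {0..<k}" by (rule inj_on_cong) simp
    then have "inj_on ?p {0..<k}" using inj_iff[of z] z(2) by simp
    moreover have "?p ` {0..<k} \<subseteq> {0..<k}" using z(1) h_in by auto
    ultimately have "bij_betw ?p {0..<k} {0..<k}"
      unfolding bij_betw_def using endo_inj_surj[OF finite_atLeastLessThan] by blast
    then have p: "?p permutes {0..<k}" by (rule bij_imp_permutes) simp
    then show "?p \<in> {p. p permutes {0..<k}}" by simp
    have "tournament_on {0..<k} (<)" by (rule tournament_on_less[of "\<lambda>x. x"]) simp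
    then have "sign ?p = order_sgn {0..<k} (<) (\<lambda>i j. ?p i < ?p j)"
      using order_sgn_permutes[OF p] by simp
    also have "\<dots> = order_sgn {0..<k} (<) (\<lambda>i j. z (h i) < z (h j))"
      by (rule order_sgn_cong) simp_all
    also have "\<dots> = map_sgn A r z"
      using map_sgn_enumeration[where r = r and \<beta> = z, OF bij] h inj_iff[of z] z(2) by simp
    finally have "map_sgn A r z = sign ?p" ..
    moreover have "(\<Prod>a\<in>A. B a (z a)) = (\<Prod>i = 0..<k. B (h i) (?p i))"
      using prod.reindex_bij_betw[OF bij, of "\<lambda>a. B a (z a)"] by simp
    ultimately show "of_int (sign ?p) * (\<Prod>i = 0..<k. B (h i) (?p i)) =
        real_of_int (map_sgn A r z) * (\<Prod>a\<in>A. B a (z a))"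
      by simp
  next
    fix p
    assume "p \<in> {p. p permutes {0..<k}}"
    then have p: "p permutes {0..<k}" by simp
    show "(\<lambda>i. if i < k then (\<lambda>a\<in>A. p (?g a)) (h i) else i) = p"
    proof
      fix i
      show "(if i < k then (\<lambda>a\<in>A. p (?g a)) (h i) else i) = p i"
        by (cases "i < k") (simp_all add: h_in gh permutes_not_in[OF p])
    qed
    have p_in: "p i < k" if "i < k" for i using permutes_in_image[OF p, of i] that by simp
    have "inj_on (\<lambda>a\<in>A. p (?g a)) A"
    proof (rule inj_onI)
      fix a b
      assume ab: "a \<in> A" "b \<in> A" "(\<lambda>a\<in>A. p (?g a)) a = (\<lambda>a\<in>A. p (?g a)) b"
      then have "p (?g a) = p (?g b)" by simp
      then have "?g a = ?g b" by (rule injD[OF permutes_inj[OF p]])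
      then show "a = b" using hg(1) ab(1,2) by metis
    qed
    then show "(\<lambda>a\<in>A. p (?g a)) \<in> {z \<in> A \<rightarrow>\<^sub>E {0..<k}. inj_on z A}"
      using hg(2) p_in by auto
  qed
  also have "\<dots> = det (mat k k (\<lambda>(i, j). B (h i) j))"
  proof -
    have "(\<Prod>i = 0..<k. B (h i) (p i)) = (\<Prod>i = 0..<k. mat k k (\<lambda>(i, j). B (h i) j) $$ (i, p i))"
      if "p permutes {0..<k}" for p
    proof (rule prod.cong[OF refl])
      fix i
      assume "i \<in> {0..<k}"
      moreover from this have "p i \<in> {0..<k}" using permutes_in_image[OF that] by simp
      ultimately show "B (h i) (p i) = mat k k (\<lambda>(i, j). B (h i) j) $$ (i, p i)" by simp
    qed
    then show ?thesis
      unfolding det_def'[OF mat_carrier] by (intro sum.cong refl) simp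
  qed
  finally show ?thesis .
qed

text \<open>This is the rotation of one vertex tensor in coordinates: the sum expands the
  determinant whose rows are the rows \<open>y a\<close> of \<open>Q\<close>. Only the first
  \<open>k\<close> columns occur, since the tensor of \<open>k\<close>-colourings has no component
  along the last axis.\<close>

lemma map_sgn_orthogonal:
  fixes Q :: "nat \<Rightarrow> nat \<Rightarrow> real"
  assumes A: "finite A" "card A = k" "linear_order_on A r"
    and minors: "\<And>j. j \<le> k \<Longrightarrow> det (mat k k (\<lambda>(i, i'). Q (if i < j then i else Suc i) i')) = d"
    and y: "\<And>a. a \<in> A \<Longrightarrow> y a \<le> k"
  shows "(\<Sum>z\<in>A \<rightarrow>\<^sub>E {0..<k}. real_of_int (map_sgn A r z) * (\<Prod>a\<in>A. Q (y a) (z a))) =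
    d * real_of_int (map_sgn A r y)"
proof -
  obtain h where bij: "bij_betw h {0..<k} A" and
    h: "\<And>i j. i < k \<Longrightarrow> j < k \<Longrightarrow> (h i, h j) \<in> r \<and> h i \<noteq> h j \<longleftrightarrow> i < j"
    using linear_order_enumeration[OF A(1,3)] A(2) by metis
  have "y (h i) \<le> k" if "i < k" for i using y bij_betw_apply[OF bij] that by simp
  then have "det (mat k k (\<lambda>(i, j). Q (y (h i)) j)) = d * real_of_int (map_sgn A r y)"
    using det_rows_of_colouring[of k Q d "\<lambda>i. y (h i)", OF minors]
      map_sgn_enumeration[where r = r and \<beta> = y, OF bij] h by simp
  moreover have "(\<Sum>z\<in>A \<rightarrow>\<^sub>E {0..<k}. real_of_int (map_sgn A r z) * (\<Prod>a\<in>A. Q (y a) (z a))) =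
      det (mat k k (\<lambda>(i, j). Q (y (h i)) j))"
    by (rule sum_map_sgn_eq_det[OF bij]) (rule h)
  ultimately show ?thesis by simp
qed

section \<open>Eliminating one colour\<close>

lemma map_sgn_cong:
  assumes "\<And>a. a \<in> A \<Longrightarrow> \<beta> a = \<gamma> a"
  shows "map_sgn A r \<beta> = map_sgn A r \<gamma>"
proof -
  have "inj_on \<beta> A \<longleftrightarrow> inj_on \<gamma> A" by (rule inj_on_cong) (rule assms)
  moreover have "{(l, m) \<in> A \<times> A. (l, m) \<in> r \<and> l \<noteq> m \<and> \<beta> l > \<beta> m} =
      {(l, m) \<in> A \<times> A. (l, m) \<in> r \<and> l \<noteq> m \<and> \<gamma> l > \<gamma> m}"
    using assms by auto
  ultimately show ?thesis unfolding map_sgn_def by (simp only:)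
qed

lemma prod_half_edges_swap:
  fixes F :: "'v \<times> 'e \<Rightarrow> 'c :: comm_monoid_mult"
  assumes "finite_graph G"
  shows "(\<Prod>v\<in>verts G. \<Prod>h\<in>half_edges G v. F h) = (\<Prod>e\<in>edges G. \<Prod>v\<in>ends G e. F (v, e))"
proof -
  have fin: "finite (verts G)" "finite (edges G)" using assms by (simp_all add: finite_graph_def)
  have "(\<Prod>h\<in>half_edges G v. F h) = (\<Prod>e\<in>{e \<in> edges G. v \<in> ends G e}. F (v, e))" for v
  proof -
    have "half_edges G v = Pair v ` {e \<in> edges G. v \<in> ends G e}" by (auto simp: half_edges_def)
    then show ?thesis by (simp add: prod.reindex inj_on_def)
  qed
  then have "(\<Prod>v\<in>verts G. \<Prod>h\<in>half_edges G v. F h) =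
      (\<Prod>v\<in>verts G. \<Prod>e\<in>{e \<in> edges G. v \<in> ends G e}. F (v, e))"
    by simp
  also have "\<dots> = (\<Prod>e\<in>edges G. \<Prod>v\<in>{v \<in> verts G. v \<in> ends G e}. F (v, e))"
    by (rule prod.swap_restrict[OF fin])
  also have "\<dots> = (\<Prod>e\<in>edges G. \<Prod>v\<in>ends G e. F (v, e))"
  proof (rule prod.cong[OF refl])
    fix e
    assume "e \<in> edges G"
    then have "ends G e \<subseteq> verts G" using assms by (simp add: finite_graph_def)
    then have "{v \<in> verts G. v \<in> ends G e} = ends G e" by blast
    then show "(\<Prod>v\<in>{v \<in> verts G. v \<in> ends G e}. F (v, e)) = (\<Prod>v\<in>ends G e. F (v, e))"
      by (simp only:)
  qed
  finally show ?thesis .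
qed

text \<open>Summing over the colour of an edge pairs two columns of \<open>Q\<close>, and these are
  orthonormal. Agreement is phrased over all pairs from \<open>S\<close> because the two ends carry
  no order.\<close>

lemma sum_edge_contraction:
  fixes Q :: "nat \<Rightarrow> nat \<Rightarrow> real"
  assumes "card S = 2"
    and orth: "\<And>a b. a \<le> k \<Longrightarrow> b \<le> k \<Longrightarrow> (\<Sum>i\<le>k. Q i a * Q i b) = (if a = b then 1 else 0)"
    and c: "\<And>v. v \<in> S \<Longrightarrow> c v \<le> k"
  shows "(\<Sum>i\<in>{0..k}. \<Prod>v\<in>S. Q i (c v)) = (if \<forall>u\<in>S. \<forall>v\<in>S. c u = c v then 1 else 0)"
proof -
  obtain u v where S: "S = {u, v}" "u \<noteq> v" using assms(1) by (auto simp: card_2_iff)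
  have "(\<Sum>i\<in>{0..k}. \<Prod>v\<in>S. Q i (c v)) = (\<Sum>i\<le>k. Q i (c u) * Q i (c v))"
    using S by (simp add: atLeast0AtMost)
  also have "\<dots> = (if c u = c v then 1 else 0)" by (rule orth) (use c S in auto)
  also have "c u = c v \<longleftrightarrow> (\<forall>u\<in>S. \<forall>v\<in>S. c u = c v)"
    unfolding S(1) by (metis insertE insertI1 insertI2 singletonD)
  finally show ?thesis .
qed

text \<open>Half-edge colourings that agree along edges are edge colourings in disguise; the nested
  restrictions make the correspondence exact for extensional functions.\<close>

lemma sum_compatible_half_edge_colourings:
  fixes F :: "('v \<Rightarrow> 'v \<times> 'e \<Rightarrow> nat) \<Rightarrow> 'c :: comm_monoid_add"
  assumes G: "finite_graph G"
  shows "(\<Sum>g\<in>{g \<in> (\<Pi>\<^sub>E v\<in>verts G. half_edges G v \<rightarrow>\<^sub>E {0..<k}).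
        \<forall>e\<in>edges G. \<forall>u\<in>ends G e. \<forall>v\<in>ends G e. g u (u, e) = g v (v, e)}. F g) =
    (\<Sum>x\<in>edges G \<rightarrow>\<^sub>E {0..<k}. F (\<lambda>v\<in>verts G. \<lambda>h\<in>half_edges G v. x (snd h)))"
proof (rule sum.reindex_bij_witness[of _ "\<lambda>x. \<lambda>v\<in>verts G. \<lambda>h\<in>half_edges G v. x (snd h)"
      "\<lambda>g. \<lambda>e\<in>edges G. g (SOME v. v \<in> ends G e) (SOME v. v \<in> ends G e, e)"])
  \<comment> \<open>The colour of an edge is read off at an arbitrary end; agreement makes the
    choice immaterial.\<close>
  let ?end = "\<lambda>e. SOME v. v \<in> ends G e"
  have some_end: "?end e \<in> ends G e" if "e \<in> edges G" for e
  proof -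
    have "card (ends G e) = 2" using G that by (simp add: finite_graph_def)
    then have "ends G e \<noteq> {}" by auto
    then show ?thesis by (simp add: some_in_eq)
  qed
  have end_vert: "v \<in> verts G" "(v, e) \<in> half_edges G v" if "e \<in> edges G" "v \<in> ends G e" for v e
    using G that by (auto simp: finite_graph_def half_edges_def)
  {
    fix g
    assume g': "g \<in> {g \<in> (\<Pi>\<^sub>E v\<in>verts G. half_edges G v \<rightarrow>\<^sub>E {0..<k}).
        \<forall>e\<in>edges G. \<forall>u\<in>ends G e. \<forall>v\<in>ends G e. g u (u, e) = g v (v, e)}"
    then have g: "g \<in> (\<Pi>\<^sub>E v\<in>verts G. half_edges G v \<rightarrow>\<^sub>E {0..<k})" by simp
    have agree: "g u (u, e) = g v (v, e)" if "e \<in> edges G" "u \<in> ends G e" "v \<in> ends G e" for u v e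
      using g' that by blast
    have gv: "g v \<in> half_edges G v \<rightarrow>\<^sub>E {0..<k}" if "v \<in> verts G" for v
      using PiE_mem[OF g that] .
    let ?x = "\<lambda>e\<in>edges G. g (?end e) (?end e, e)"
    show "?x \<in> edges G \<rightarrow>\<^sub>E {0..<k}"
      using PiE_mem[OF gv] end_vert some_end by (intro restrict_PiE_iff[THEN iffD2] ballI) blast
    show eq: "(\<lambda>v\<in>verts G. \<lambda>h\<in>half_edges G v. ?x (snd h)) = g"
    proof (rule extensionalityI[of _ "verts G"])
      show "g \<in> extensional (verts G)" using g by (simp add: PiE_def)
      fix v
      assume v: "v \<in> verts G"
      have "(\<lambda>h\<in>half_edges G v. ?x (snd h)) = g v"
      proof (rule extensionalityI[of _ "half_edges G v"])
        show "g v \<in> extensional (half_edges G v)" using gv[OF v] by (simp add: PiE_def)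
        fix h
        assume h: "h \<in> half_edges G v"
        then obtain e where e: "h = (v, e)" "e \<in> edges G" "v \<in> ends G e"
          by (auto simp: half_edges_def)
        have "(\<lambda>h\<in>half_edges G v. ?x (snd h)) h = ?x e" using h e by simp
        also have "\<dots> = g (?end e) (?end e, e)" using e by simp
        also have "\<dots> = g v h" unfolding e(1) by (rule agree[OF e(2) some_end[OF e(2)] e(3)])
        finally show "(\<lambda>h\<in>half_edges G v. ?x (snd h)) h = g v h" .
      qed simp
      then show "(\<lambda>v\<in>verts G. \<lambda>h\<in>half_edges G v. ?x (snd h)) v = g v" using v by simp
    qed simp
    show "F (\<lambda>v\<in>verts G. \<lambda>h\<in>half_edges G v. ?x (snd h)) = F g" unfolding eq ..
  next
    fix x
    assume x: "x \<in> edges G \<rightarrow>\<^sub>E {0..<k}"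
    let ?g = "\<lambda>v\<in>verts G. \<lambda>h\<in>half_edges G v. x (snd h)"
    have g_eq: "?g v (v, e) = x e" if "e \<in> edges G" "v \<in> ends G e" for v e
      using end_vert[OF that] by simp
    have "x (snd h) \<in> {0..<k}" if "h \<in> half_edges G v" for v h
      using PiE_mem[OF x, of "snd h"] that by (auto simp: half_edges_def)
    then have "?g \<in> (\<Pi>\<^sub>E v\<in>verts G. half_edges G v \<rightarrow>\<^sub>E {0..<k})"
      by (intro restrict_PiE_iff[THEN iffD2] ballI)
    then show "?g \<in> {g \<in> (\<Pi>\<^sub>E v\<in>verts G. half_edges G v \<rightarrow>\<^sub>E {0..<k}).
        \<forall>e\<in>edges G. \<forall>u\<in>ends G e. \<forall>v\<in>ends G e. g u (u, e) = g v (v, e)}"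
      by (simp add: g_eq del: restrict_apply)
    show "(\<lambda>e\<in>edges G. ?g (?end e) (?end e, e)) = x"
    proof (rule extensionalityI[of _ "edges G"])
      fix e
      assume e: "e \<in> edges G"
      then show "(\<lambda>e\<in>edges G. ?g (?end e) (?end e, e)) e = x e"
        using g_eq[OF e some_end[OF e]] by (simp del: restrict_apply add: restrict_apply'[OF e])
    qed (use x in \<open>simp_all add: PiE_def\<close>)
  }
qed

lemma prod_of_bool_conditions:
  "finite A \<Longrightarrow> (\<Prod>a\<in>A. if P a then 1 else 0) = (if \<forall>a\<in>A. P a then 1 else (0 :: real))"
  by (induction A rule: finite_induct) simp_all

text \<open>Rotating every vertex tensor uses one factor \<open>d\<close> per vertex and gives each
  half-edge its own new colour from \<open>{0..<k}\<close>. After the sums are interchanged, the old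
  colour of each edge is summed out separately, and orthogonality identifies the new colours at its
  two ends.\<close>

lemma sum_colouring_sgn_eliminate_colour:
  fixes Q :: "nat \<Rightarrow> nat \<Rightarrow> real"
  assumes G: "finite_graph G" "regular k G"
    and r: "\<And>v. v \<in> verts G \<Longrightarrow> linear_order_on (half_edges G v) (r v)"
    and orth: "\<And>a b. a \<le> k \<Longrightarrow> b \<le> k \<Longrightarrow> (\<Sum>i\<le>k. Q i a * Q i b) = (if a = b then 1 else 0)"
    and minors: "\<And>j. j \<le> k \<Longrightarrow> det (mat k k (\<lambda>(i, i'). Q (if i < j then i else Suc i) i')) = d"
  shows "d ^ card (verts G) * (\<Sum>y\<in>edges G \<rightarrow>\<^sub>E {0..k}. real_of_int (colouring_sgn G r y)) =
    (\<Sum>x\<in>edges G \<rightarrow>\<^sub>E {0..<k}. real_of_int (colouring_sgn G r x))"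
proof -
  let ?V = "verts G" and ?E = "edges G" and ?H = "half_edges G"
  let ?s = "\<lambda>v z. real_of_int (map_sgn (?H v) (r v) z)"
  let ?Z = "\<lambda>v. ?H v \<rightarrow>\<^sub>E {0..<k}"
  let ?agree = "\<lambda>g. \<forall>e\<in>?E. \<forall>u\<in>ends G e. \<forall>v\<in>ends G e. g u (u, e) = g v (v, e)"
  have fin: "finite ?V" "finite ?E" using G(1) by (simp_all add: finite_graph_def)
  have finZ: "finite (?Z v)" for v
    using finite_half_edges[OF G(1)] by (intro finite_PiE) simp_all
  have sgn: "real_of_int (colouring_sgn G r y) = (\<Prod>v\<in>?V. ?s v (\<lambda>h. y (snd h)))" for y
  proof -
    have eq: "(\<lambda>(v, e). y e) = (\<lambda>h. y (snd h))" by auto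
    show ?thesis unfolding colouring_sgn_def eq by simp
  qed
  have expand: "d ^ card ?V * real_of_int (colouring_sgn G r y) =
     (\<Sum>g\<in>Pi\<^sub>E ?V ?Z. (\<Prod>v\<in>?V. ?s v (g v)) * (\<Prod>e\<in>?E. \<Prod>v\<in>ends G e. Q (y e) (g v (v, e))))"
    if y: "y \<in> ?E \<rightarrow>\<^sub>E {0..k}" for y
  proof -
    have "d ^ card ?V * real_of_int (colouring_sgn G r y) = (\<Prod>v\<in>?V. d * ?s v (\<lambda>h. y (snd h)))"
      unfolding sgn by (simp add: prod.distrib)
    also have "\<dots> = (\<Prod>v\<in>?V. \<Sum>z\<in>?Z v. ?s v z * (\<Prod>h\<in>?H v. Q (y (snd h)) (z h)))"
    proof (rule prod.cong[OF refl])
      fix v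
      assume v: "v \<in> ?V"
      show "d * ?s v (\<lambda>h. y (snd h)) = (\<Sum>z\<in>?Z v. ?s v z * (\<Prod>h\<in>?H v. Q (y (snd h)) (z h)))"
      proof (rule map_sgn_orthogonal[symmetric])
        show "card (?H v) = k" using G(2) v by (simp add: regular_def)
        show "y (snd h) \<le> k" if "h \<in> ?H v" for h
          using PiE_mem[OF y, of "snd h"] that by (auto simp: half_edges_def)
      qed (use finite_half_edges[OF G(1)] r[OF v] minors in simp_all)
    qed
    also have "\<dots> = (\<Sum>g\<in>Pi\<^sub>E ?V ?Z. \<Prod>v\<in>?V. ?s v (g v) * (\<Prod>h\<in>?H v. Q (y (snd h)) (g v h)))"
      by (rule prod_sum_PiE[OF fin(1) finZ])
    also have "\<dots> = (\<Sum>g\<in>Pi\<^sub>E ?V ?Z. (\<Prod>v\<in>?V. ?s v (g v)) * (\<Prod>e\<in>?E. \<Prod>v\<in>ends G e. Q (y e) (g v (v, e))))"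
    proof (rule sum.cong[OF refl])
      fix g
      \<comment> \<open>Inside \<open>half_edges G v\<close> the vertex is \<open>fst h\<close>; the
        factor thereby depends on the half-edge alone and can be regrouped by edges.\<close>
      have "(\<Prod>v\<in>?V. \<Prod>h\<in>?H v. Q (y (snd h)) (g v h)) = (\<Prod>v\<in>?V. \<Prod>h\<in>?H v. Q (y (snd h)) (g (fst h) h))"
        by (intro prod.cong refl) (auto simp: half_edges_def)
      also have "\<dots> = (\<Prod>e\<in>?E. \<Prod>v\<in>ends G e. Q (y e) (g v (v, e)))"
        using prod_half_edges_swap[OF G(1), of "\<lambda>h. Q (y (snd h)) (g (fst h) h)"] by simp
      finally show "(\<Prod>v\<in>?V. ?s v (g v) * (\<Prod>h\<in>?H v. Q (y (snd h)) (g v h))) =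
          (\<Prod>v\<in>?V. ?s v (g v)) * (\<Prod>e\<in>?E. \<Prod>v\<in>ends G e. Q (y e) (g v (v, e)))"
        by (simp add: prod.distrib)
    qed
    finally show ?thesis .
  qed
  have contract: "(\<Sum>y\<in>?E \<rightarrow>\<^sub>E {0..k}. \<Prod>e\<in>?E. \<Prod>v\<in>ends G e. Q (y e) (g v (v, e))) =
      (if ?agree g then 1 else 0)" if g: "g \<in> Pi\<^sub>E ?V ?Z" for g
  proof -
    have "(\<Sum>y\<in>?E \<rightarrow>\<^sub>E {0..k}. \<Prod>e\<in>?E. \<Prod>v\<in>ends G e. Q (y e) (g v (v, e))) =
        (\<Prod>e\<in>?E. \<Sum>i\<in>{0..k}. \<Prod>v\<in>ends G e. Q i (g v (v, e)))"
      by (rule prod_sum_PiE[symmetric]) (use fin in simp_all)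
    also have "\<dots> = (\<Prod>e\<in>?E. if \<forall>u\<in>ends G e. \<forall>v\<in>ends G e. g u (u, e) = g v (v, e) then 1 else 0)"
    proof (rule prod.cong[OF refl])
      fix e
      assume e: "e \<in> ?E"
      then have ends: "card (ends G e) = 2" "ends G e \<subseteq> ?V"
        using G(1) by (simp_all add: finite_graph_def)
      show "(\<Sum>i\<in>{0..k}. \<Prod>v\<in>ends G e. Q i (g v (v, e))) =
          (if \<forall>u\<in>ends G e. \<forall>v\<in>ends G e. g u (u, e) = g v (v, e) then 1 else 0)"
      proof (rule sum_edge_contraction[OF ends(1) orth])
        fix v
        assume v: "v \<in> ends G e"
        then have "v \<in> ?V" "(v, e) \<in> ?H v" using ends(2) e by (auto simp: half_edges_def)
        then have "g v (v, e) \<in> {0..<k}" using PiE_mem[OF PiE_mem[OF g]] by blast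
        then show "g v (v, e) \<le> k" by simp
      qed
    qed
    also have "\<dots> = (if ?agree g then 1 else 0)"
      by (rule prod_of_bool_conditions[OF fin(2)])
    finally show ?thesis .
  qed
  have "d ^ card ?V * (\<Sum>y\<in>?E \<rightarrow>\<^sub>E {0..k}. real_of_int (colouring_sgn G r y)) =
     (\<Sum>y\<in>?E \<rightarrow>\<^sub>E {0..k}. \<Sum>g\<in>Pi\<^sub>E ?V ?Z. (\<Prod>v\<in>?V. ?s v (g v)) *
        (\<Prod>e\<in>?E. \<Prod>v\<in>ends G e. Q (y e) (g v (v, e))))"
    unfolding sum_distrib_left by (intro sum.cong refl expand)
  \<comment> \<open>For fixed \<open>g\<close> only the edge factors depend on \<open>y\<close>, and
    their sum is the one evaluated in \<open>contract\<close>.\<close>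
  also have "\<dots> = (\<Sum>g\<in>Pi\<^sub>E ?V ?Z. (\<Prod>v\<in>?V. ?s v (g v)) *
        (\<Sum>y\<in>?E \<rightarrow>\<^sub>E {0..k}. \<Prod>e\<in>?E. \<Prod>v\<in>ends G e. Q (y e) (g v (v, e))))"
    unfolding sum_distrib_left by (rule sum.swap)
  also have "\<dots> = (\<Sum>g\<in>Pi\<^sub>E ?V ?Z. if ?agree g then \<Prod>v\<in>?V. ?s v (g v) else 0)"
  proof (rule sum.cong[OF refl])
    fix g
    assume g: "g \<in> Pi\<^sub>E ?V ?Z"
    have "c * (if b then 1 else 0) = (if b then c else (0 :: real))" for b c by simp
    then show "(\<Prod>v\<in>?V. ?s v (g v)) *
        (\<Sum>y\<in>?E \<rightarrow>\<^sub>E {0..k}. \<Prod>e\<in>?E. \<Prod>v\<in>ends G e. Q (y e) (g v (v, e))) =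
        (if ?agree g then \<Prod>v\<in>?V. ?s v (g v) else 0)"
      unfolding contract[OF g] .
  qed
  also have "\<dots> = (\<Sum>g\<in>{g \<in> Pi\<^sub>E ?V ?Z. ?agree g}. \<Prod>v\<in>?V. ?s v (g v))"
    by (rule sum.inter_filter[symmetric]) (intro finite_PiE fin finZ)
  also have "\<dots> = (\<Sum>x\<in>?E \<rightarrow>\<^sub>E {0..<k}. \<Prod>v\<in>?V. ?s v ((\<lambda>v\<in>?V. \<lambda>h\<in>?H v. x (snd h)) v))"
    by (rule sum_compatible_half_edge_colourings[OF G(1)])
  also have "\<dots> = (\<Sum>x\<in>?E \<rightarrow>\<^sub>E {0..<k}. real_of_int (colouring_sgn G r x))"
    unfolding sgn
  proof (intro sum.cong prod.cong refl arg_cong[of _ _ real_of_int])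
    fix x v
    assume "v \<in> ?V"
    then show "map_sgn (?H v) (r v) ((\<lambda>v\<in>?V. \<lambda>h\<in>?H v. x (snd h)) v) =
        map_sgn (?H v) (r v) (\<lambda>h. x (snd h))"
      by (intro map_sgn_cong) simp
  qed
  finally show ?thesis .
qed

section \<open>Signs of single colourings and the final formula\<close>

lemma colouring_sgn_not_proper:
  assumes G: "finite_graph G" and x: "x \<in> edges G \<rightarrow>\<^sub>E {0..<k}" "x \<notin> proper_edge_colourings G k"
  shows "colouring_sgn G r x = 0"
proof -
  obtain v where v: "v \<in> verts G" "\<not> inj_on (\<lambda>h. x (snd h)) (half_edges G v)"
    using x unfolding proper_edge_colourings_iff[OF G] by blast
  have eq: "(\<lambda>(v, e). x e) = (\<lambda>h. x (snd h))" by auto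
  have "map_sgn (half_edges G v) (r v) (\<lambda>(v, e). x e) = 0"
    unfolding eq map_sgn_def using v(2) by simp
  then show ?thesis
    using G v(1) unfolding colouring_sgn_def finite_graph_def by (intro prod_zero) auto
qed

lemma colouring_sgn_proper:
  assumes G: "finite_graph G" and x: "x \<in> proper_edge_colourings G k"
  shows "colouring_sgn G r x = 1 \<or> colouring_sgn G r x = -1"
proof -
  have eq: "(\<lambda>(v, e). x e) = (\<lambda>h. x (snd h))" by auto
  have "\<bar>map_sgn (half_edges G v) (r v) (\<lambda>(v, e). x e)\<bar> = 1" if "v \<in> verts G" for v
    using x that unfolding proper_edge_colourings_iff[OF G] eq map_sgn_def by (simp add: power_abs)
  then have "\<bar>colouring_sgn G r x\<bar> = 1" unfolding colouring_sgn_def abs_prod by simp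
  then show ?thesis by linarith
qed

theorem theorem4p11:
  fixes G :: "('v, 'e) graph" and k :: nat
    and r :: "'v \<Rightarrow> (('v \<times> 'e) \<times> ('v \<times> 'e)) set"
  assumes "k \<ge> 1"
    and "finite_graph G"
    and "regular k G"
    and "admits_pfaffian_labelling TYPE('g) G"
    and "\<And>v. v \<in> verts G \<Longrightarrow> linear_order_on (half_edges G v) (r v)"
  shows "\<exists>\<epsilon>\<in>{1, -1 :: real}.
           \<epsilon> * real (line_graph_chromatic G k) =
           real (k + 1) powr (- real (card (verts G)) / 2) *
           real_of_int (\<Sum>y\<in>edges G \<rightarrow>\<^sub>E {0..k}. colouring_sgn G r y)"
proof -
  let ?C = "proper_edge_colourings G k" and ?n = "card (verts G)"
  let ?S = "\<Sum>y\<in>edges G \<rightarrow>\<^sub>E {0..k}. real_of_int (colouring_sgn G r y)"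
  obtain \<Gamma> :: "'g monoid" and z vs l where pf: "pfaffian_labelling G \<Gamma> z vs l"
    using assms(4) unfolding admits_pfaffian_labelling_def by blast
  \<comment> \<open>Without proper colourings either sign serves as \<open>K\<close>, since it only
    multiplies the chromatic value 0.\<close>
  have "\<exists>K::real. (K = 1 \<or> K = -1) \<and> (\<forall>x\<in>?C. real_of_int (colouring_sgn G r x) = K)"
  proof (cases "?C = {}")
    case False
    then obtain x0 where x0: "x0 \<in> ?C" by blast
    have "\<forall>x\<in>?C. colouring_sgn G r x = colouring_sgn G r x0"
      using colouring_sgn_eq_const[where r = r, OF assms(2,3) pf assms(5)] x0 by blast
    then show ?thesis
      using colouring_sgn_proper[OF assms(2) x0, of r]
      by (intro exI[of _ "real_of_int (colouring_sgn G r x0)"]) auto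
  qed auto
  then obtain K :: real where K: "K = 1 \<or> K = -1" "\<And>x. x \<in> ?C \<Longrightarrow> real_of_int (colouring_sgn G r x) = K"
    by blast
  have "(\<Sum>x\<in>edges G \<rightarrow>\<^sub>E {0..<k}. real_of_int (colouring_sgn G r x)) =
      (\<Sum>x\<in>?C. real_of_int (colouring_sgn G r x))"
  proof (rule sum.mono_neutral_right)
    show "finite (edges G \<rightarrow>\<^sub>E {0..<k})"
      using assms(2) by (intro finite_PiE) (simp_all add: finite_graph_def)
    show "?C \<subseteq> edges G \<rightarrow>\<^sub>E {0..<k}" unfolding proper_edge_colourings_def by blast
    show "\<forall>x\<in>(edges G \<rightarrow>\<^sub>E {0..<k}) - ?C. real_of_int (colouring_sgn G r x) = 0"
      using colouring_sgn_not_proper[OF assms(2)] by auto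
  qed
  also have "\<dots> = K * real (line_graph_chromatic G k)"
    unfolding line_graph_chromatic_def using K(2) by simp
  finally have sum: "(\<Sum>x\<in>edges G \<rightarrow>\<^sub>E {0..<k}. real_of_int (colouring_sgn G r x)) =
      K * real (line_graph_chromatic G k)" .
  obtain Q :: "nat \<Rightarrow> nat \<Rightarrow> real" and \<delta> :: real where
    orth: "\<And>a b. a \<le> k \<Longrightarrow> b \<le> k \<Longrightarrow> (\<Sum>i\<le>k. Q i a * Q i b) = (if a = b then 1 else 0)" and
    \<delta>: "\<delta> = 1 \<or> \<delta> = -1" and
    minors: "\<And>j. j \<le> k \<Longrightarrow>
      det (mat k k (\<lambda>(i, i'). Q (if i < j then i else Suc i) i')) = \<delta> / sqrt (real (k + 1))"
    using orthogonal_matrix_minors[OF assms(1)] by blast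
  define q where "q = 1 / sqrt (real (k + 1))"
  have "(\<delta> * q) ^ ?n * ?S = K * real (line_graph_chromatic G k)"
    using sum_colouring_sgn_eliminate_colour[where r = r, OF assms(2,3,5) orth minors] sum
    unfolding q_def by simp
  \<comment> \<open>\<open>\<delta> ^ ?n\<close> is its own inverse and moves to the other side,
    where it joins the sign.\<close>
  then have "\<delta> ^ ?n * (\<delta> ^ ?n * q ^ ?n * ?S) = \<delta> ^ ?n * (K * real (line_graph_chromatic G k))"
    by (simp only: power_mult_distrib)
  moreover have "\<delta> ^ ?n * \<delta> ^ ?n = 1"
    using \<delta> by (auto simp: power_mult_distrib[symmetric])
  ultimately have "q ^ ?n * ?S = (\<delta> ^ ?n * K) * real (line_graph_chromatic G k)"
    by (simp add: mult.assoc[symmetric])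
  moreover have "real (k + 1) powr (- real ?n / 2) = q ^ ?n"
  proof -
    have "q = real (k + 1) powr (- 1 / 2)"
      unfolding q_def by (simp add: powr_minus_divide powr_half_sqrt)
    moreover have "q > 0" unfolding q_def by simp
    ultimately show ?thesis
      by (simp add: powr_realpow[symmetric] powr_powr)
  qed
  \<comment> \<open>The sign in the formula combines the common sign of all proper colourings with
    one determinant of \<open>Q\<close> per vertex.\<close>
  moreover have "\<delta> ^ ?n * K \<in> {1, -1}"
    using \<delta> K(1) by (cases "even ?n") auto
  ultimately show ?thesis
    by (intro bexI[of _ "\<delta> ^ ?n * K"]) simp_all
qed

end
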